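(* Let $G$ be a ($5$-dimensional) Lie group endowed with a left-invariant double hypo structure $(\eta,\omega_1,\omega_2,\omega_3)$. If the Lie algebra $\mathfrak{g}$ of $G$ satisfies $[\mathfrak{g},\mathfrak{g}]\neq\mathfrak{g}$, then there are a basis $e^1,\dots,e^5$ of $\mathfrak{g}^*$ and a real number $\mu$ such that $$\eta=e^5,\quad \omega_1=e^{12}+e^{34},\quad \omega_2=e^{13}+e^{42},\quad \omega_3=e^{14}+e^{23},$$ and $$\begin{aligned} de^1&=0,\\ de^2&=\mu e^{34}-3e^{35},\\ de^3&=-\mu e^{24}+3e^{25},\\ de^4&=\mu e^{14},\\ de^5&=-4e^{23}+\tfrac{\mu^2}{3}(e^{14}-e^{23}).\end{aligned}$$
   Context: Here $e^{ij}=e^i\wedge e^j$ and $d$ is the Chevalley–Eilenberg differential (the exterior derivative on left-invariant forms). An $SU(2)$-structure on a $5$-manifold is a quadruplet $(\eta,\omega_1,\omega_2,\omega_3)$ of a $1$-form $\eta$ and $2$-forms $\omega_i$ with $\omega_i\wedge\omega_j=\delta_{ij}v$ for some $4$-form $v$ with $v\wedge\eta$ nowhere zero, and such that $X\lrcorner\omega_1=Y\lrcorner\omega_2$ implies $\omega_3(X,Y)\ge 0$. It is nearly hypo if $d\omega_1=3\eta\wedge\omega_2$ and $d(\eta\wedge\omega_3)=-2\omega_1\wedge\omega_1$. It is double hypo if it is nearly hypo and also hypo, where here hypo is understood with $\omega_3$ as the closed form, i.e. $d\omega_3=0$, $d(\eta\wedge\omega_1)=0$, $d(\eta\wedge\omega_2)=0$.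 *)

theory Defs
  imports "HOL-Analysis.Analysis" "HOL-Library.Function_Algebras"
begin

section \<open>Real Lie algebras\<close>

definition lie_algebra :: "('a::real_vector \<Rightarrow> 'a \<Rightarrow> 'a) \<Rightarrow> bool" where
  "lie_algebra br \<longleftrightarrow>
     bilinear br \<and>
     (\<forall>x. br x x = 0) \<and>
     (\<forall>x y z. br x (br y z) + br y (br z x) + br z (br x y) = 0)"

definition derived_algebra :: "('a::real_vector \<Rightarrow> 'a \<Rightarrow> 'a) \<Rightarrow> 'a set" where
  "derived_algebra br = span {br x y |x y. True}"

section \<open>Exterior forms\<close>

text \<open>
  An exterior form on the vector space \<open>'a\<close> is a function on lists of vectors. A \<open>k\<close>-form
  is evaluated on lists of length \<open>k\<close> and vanishes on lists of any other length, so that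
  equality of \<open>k\<close>-forms is equality of functions and the operations below need no
  explicit degrees.
\<close>

type_synonym 'a form = "'a list \<Rightarrow> real"

instantiation "fun" :: (type, real_vector) real_vector
begin

definition scaleR_fun :: "real \<Rightarrow> ('a \<Rightarrow> 'b) \<Rightarrow> 'a \<Rightarrow> 'b" where
  "scaleR_fun c f = (\<lambda>x. c *\<^sub>R f x)"

instance
  by standard (simp_all add: scaleR_fun_def fun_eq_iff scaleR_add_right scaleR_add_left)

end

lemma scaleR_fun_apply [simp]: "(c *\<^sub>R f) x = c *\<^sub>R f x"
  by (simp add: scaleR_fun_def)

definition forms :: "nat \<Rightarrow> 'a::real_vector form set" where
  "forms k = {\<alpha>.
     (\<forall>xs. length xs \<noteq> k \<longrightarrow> \<alpha> xs = 0) \<and>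
     (\<forall>xs i. length xs = k \<and> i < k \<longrightarrow> linear (\<lambda>x. \<alpha> (xs[i := x]))) \<and>
     (\<forall>xs i j. length xs = k \<and> i < j \<and> j < k \<and> xs ! i = xs ! j \<longrightarrow> \<alpha> xs = 0)}"

text \<open>
  The sum over all splittings of the arguments into two sublists is a sum over shuffles;
  \<open>shuffle_sign\<close> is the sign of the permutation listing first \<open>S\<close>, then its complement,
  both increasingly. If \<open>\<alpha>\<close> is a \<open>p\<close>-form, only the sets \<open>S\<close> of cardinality \<open>p\<close> contribute.
  The normalisation is the one with
  \<open>(\<alpha> \<and> \<beta>)(x, y) = \<alpha>(x) \<beta>(y) - \<alpha>(y) \<beta>(x)\<close> for 1-forms.
\<close>

definition shuffle_sign :: "nat \<Rightarrow> nat set \<Rightarrow> real" where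
  "shuffle_sign n S = (- 1) ^ card {(i, j). i \<in> S \<and> j \<in> {..<n} - S \<and> j < i}"

definition wedge :: "'a form \<Rightarrow> 'a form \<Rightarrow> 'a form"  (infixr "\<^bold>\<and>" 80) where
  "\<alpha> \<^bold>\<and> \<beta> = (\<lambda>xs. \<Sum>S \<in> Pow {..<length xs}.
     shuffle_sign (length xs) S * \<alpha> (nths xs S) * \<beta> (nths xs (- S)))"

definition interior :: "'a \<Rightarrow> 'a form \<Rightarrow> 'a form" where
  "interior x \<alpha> = (\<lambda>xs. \<alpha> (x # xs))"

text \<open>
  The Chevalley--Eilenberg differential
  \<open>(d\<alpha>)(x\<^sub>0, \<dots>, x\<^sub>k) = \<Sum>\<^sub>i\<^sub><\<^sub>j (-1)\<^sup>i\<^sup>+\<^sup>j \<alpha>([x\<^sub>i, x\<^sub>j], x\<^sub>0, \<dots>, x\<^sub>k)\<close>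
  with \<open>x\<^sub>i\<close> and \<open>x\<^sub>j\<close> omitted from the trailing arguments.
\<close>

definition ce_diff :: "('a \<Rightarrow> 'a \<Rightarrow> 'a) \<Rightarrow> 'a form \<Rightarrow> 'a form" where
  "ce_diff br \<alpha> = (\<lambda>xs. \<Sum>(i, j) \<in> {(i, j). i < j \<and> j < length xs}.
     (- 1) ^ (i + j) * \<alpha> (br (xs ! i) (xs ! j) # nths xs (- {i, j})))"

definition coframe :: "(nat \<Rightarrow> 'a::real_vector form) \<Rightarrow> nat \<Rightarrow> bool" where
  "coframe e n \<longleftrightarrow>
     inj_on e {1..n} \<and> independent (e ` {1..n}) \<and> span (e ` {1..n}) = forms 1"

section \<open>Invariant \<open>SU(2)\<close>-structures\<close>

text \<open>
  An invariant form vanishes at one point iff it vanishes everywhere, so the requirement that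
  \<open>v \<and> \<eta>\<close> vanishes nowhere becomes \<open>v \<and> \<eta> \<noteq> 0\<close> on the Lie algebra. The 2-forms are
  \<open>\<omega> 1\<close>, \<open>\<omega> 2\<close>, \<open>\<omega> 3\<close>; other values of \<open>\<omega>\<close> are irrelevant.
\<close>

definition su2_structure :: "'a::real_vector form \<Rightarrow> (nat \<Rightarrow> 'a form) \<Rightarrow> bool" where
  "su2_structure \<eta> \<omega> \<longleftrightarrow>
     \<eta> \<in> forms 1 \<and> (\<forall>i\<in>{1..3}. \<omega> i \<in> forms 2) \<and>
     (\<exists>v \<in> forms 4.
        (\<forall>i\<in>{1..3}. \<forall>j\<in>{1..3}. \<omega> i \<^bold>\<and> \<omega> j = (if i = j then v else 0)) \<and>
        v \<^bold>\<and> \<eta> \<noteq> 0) \<and>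
     (\<forall>X Y. interior X (\<omega> 1) = interior Y (\<omega> 2) \<longrightarrow> \<omega> 3 [X, Y] \<ge> 0)"

definition nearly_hypo ::
  "('a::real_vector \<Rightarrow> 'a \<Rightarrow> 'a) \<Rightarrow> 'a form \<Rightarrow> (nat \<Rightarrow> 'a form) \<Rightarrow> bool" where
  "nearly_hypo br \<eta> \<omega> \<longleftrightarrow>
     su2_structure \<eta> \<omega> \<and>
     ce_diff br (\<omega> 1) = 3 *\<^sub>R (\<eta> \<^bold>\<and> \<omega> 2) \<and>
     ce_diff br (\<eta> \<^bold>\<and> \<omega> 3) = (- 2) *\<^sub>R (\<omega> 1 \<^bold>\<and> \<omega> 1)"

text \<open>Hypo with \<open>\<omega> 3\<close> in the role of the closed 2-form.\<close>

definition hypo ::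
  "('a::real_vector \<Rightarrow> 'a \<Rightarrow> 'a) \<Rightarrow> 'a form \<Rightarrow> (nat \<Rightarrow> 'a form) \<Rightarrow> bool" where
  "hypo br \<eta> \<omega> \<longleftrightarrow>
     su2_structure \<eta> \<omega> \<and>
     ce_diff br (\<omega> 3) = 0 \<and>
     ce_diff br (\<eta> \<^bold>\<and> \<omega> 1) = 0 \<and>
     ce_diff br (\<eta> \<^bold>\<and> \<omega> 2) = 0"

definition double_hypo ::
  "('a::real_vector \<Rightarrow> 'a \<Rightarrow> 'a) \<Rightarrow> 'a form \<Rightarrow> (nat \<Rightarrow> 'a form) \<Rightarrow> bool" where
  "double_hypo br \<eta> \<omega> \<longleftrightarrow> nearly_hypo br \<eta> \<omega> \<and> hypo br \<eta> \<omega>"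

end

theory Submission
  imports Defs
begin

text \<open>
  Contract a nonzero vector \<open>X\<close> of \<open>ker \<eta>\<close> with \<open>\<omega>\<^sub>1, \<omega>\<^sub>2, \<omega>\<^sub>3\<close>: together with \<open>\<eta>\<close> this gives four
  independent covectors, and completing them to a coframe puts any \<open>SU(2)\<close>-structure into the normal
  form \<open>\<eta> = e\<^sup>5\<close>, \<open>\<omega>\<^sub>1 = e\<^sup>1\<^sup>2 + e\<^sup>3\<^sup>4\<close>, and so on (\<open>ex_adapted_basis\<close>). Unit quaternions act transitively on
  the unit sphere of \<open>span (e\<^sup>1, \<dots>, e\<^sup>4)\<close> and preserve the normal form (\<open>adapted_basis_rotate\<close>), so \<open>e\<^sup>1\<close> may be
  given any direction in that space.

  Since \<open>[g, g] \<noteq> g\<close>, some covector \<open>\<alpha> \<noteq> 0\<close> vanishes on brackets, that is, \<open>\<alpha>\<close> is closed. It need not be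
  orthogonal to \<open>\<eta>\<close>. In general \<open>d(\<alpha> \<and> \<eta> \<and> \<omega>\<^sub>3) = 2 \<alpha> \<and> \<omega>\<^sub>1 \<and> \<omega>\<^sub>1\<close>, whose value is a multiple of the
  \<open>\<eta>\<close>-component of \<open>\<alpha>\<close>; exact 5-forms vanish on a unimodular algebra, so a nonzero component forces the
  trace form \<open>x \<mapsto> tr (ad x)\<close> to be nonzero. The trace form is closed, and it has no \<open>\<eta>\<close>-component because
  \<open>d(\<omega>\<^sub>3 \<and> \<omega>\<^sub>3) = 0\<close>. Hence \<open>\<alpha>\<close> or the trace form is a nonzero closed covector without \<open>\<eta>\<close>-component
  (\<open>ex_horizontal_closed_form\<close>), and after a rotation \<open>de\<^sup>1 = 0\<close>.

  What remains is elimination in the structure constants (\<open>coefficients_if_closed\<close>). The double hypo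
  equations are linear in them and leave eleven unknowns. The Jacobi identity kills two of these
  outright; it then yields a sum of squares that excludes \<open>de\<^sup>2\<close> without an \<open>e\<^sup>3\<^sup>5\<close> term, and a second
  sum-of-squares argument that excludes \<open>de\<^sup>5(b\<^sub>2, b\<^sub>3) = -2\<close>. After these
  two exclusions the remaining identities leave only \<open>\<mu>\<close> free and give the stated family.
\<close>

section \<open>Calculus of exterior forms\<close>

text \<open>
  The first argument \<open>x\<close> of \<open>\<alpha> \<^bold>\<and> \<beta>\<close> is passed to \<open>\<alpha>\<close> or to \<open>\<beta>\<close>. In the second case every argument of \<open>\<alpha>\<close>
  has to be moved past \<open>x\<close>. The next lemmas make this a recursion on the argument list, by which
  wedge products are evaluated on explicit lists without enumerating shuffles.
\<close>

lemma shuffle_sign_Suc_image: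
  assumes "T \<subseteq> {..<n}"
  shows "shuffle_sign (Suc n) (Suc ` T) = (- 1) ^ card T * shuffle_sign n T"
proof -
  let ?P = "{(i, j). i \<in> T \<and> j \<in> {..<n} - T \<and> j < i}"
  have fin: "finite T" using assms finite_subset by blast
  have "finite ?P" by (rule finite_subset[of _ "T \<times> {..<n}"]) (use fin in auto)
  have "{(i, j). i \<in> Suc ` T \<and> j \<in> {..<Suc n} - Suc ` T \<and> j < i}
      = (\<lambda>i. (Suc i, 0)) ` T \<union> (\<lambda>(i, j). (Suc i, Suc j)) ` ?P" (is "?L = ?A \<union> ?B")
  proof (intro set_eqI iffI)
    fix p assume "p \<in> ?L"
    then obtain i j where "p = (i, j)" "i \<in> Suc ` T" "j < Suc n" "j \<notin> Suc ` T" "j < i" by auto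
    then show "p \<in> ?A \<union> ?B" by (cases j) (auto simp: image_iff)
  qed (use assms in auto)
  moreover have "?A \<inter> ?B = {}" by auto
  moreover have "card ?A = card T" by (rule card_image) (auto simp: inj_on_def)
  moreover have "card ?B = card ?P" by (rule card_image) (auto simp: inj_on_def)
  ultimately have "card {(i, j). i \<in> Suc ` T \<and> j \<in> {..<Suc n} - Suc ` T \<and> j < i} = card T + card ?P"
    using fin \<open>finite ?P\<close> by (simp add: card_Un_disjoint)
  then show ?thesis by (simp add: shuffle_sign_def power_add)
qed

lemma shuffle_sign_insert_0:
  assumes "T \<subseteq> {..<n}"
  shows "shuffle_sign (Suc n) (insert 0 (Suc ` T)) = shuffle_sign n T"
proof -
  let ?P = "{(i, j). i \<in> T \<and> j \<in> {..<n} - T \<and> j < i}"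
  have "{(i, j). i \<in> insert 0 (Suc ` T) \<and> j \<in> {..<Suc n} - insert 0 (Suc ` T) \<and> j < i}
      = (\<lambda>(i, j). (Suc i, Suc j)) ` ?P" (is "?L = ?B")
  proof (intro set_eqI iffI)
    fix p assume "p \<in> ?L"
    then obtain i j where "p = (i, j)" "i \<in> insert 0 (Suc ` T)" "j < Suc n" "j \<notin> insert 0 (Suc ` T)" "j < i"
      by auto
    then show "p \<in> ?B" by (cases j) (auto simp: image_iff)
  qed (use assms in auto)
  moreover have "card ?B = card ?P" by (rule card_image) (auto simp: inj_on_def)
  ultimately show ?thesis by (simp add: shuffle_sign_def)
qed

lemma Pow_lessThan_Suc_shift:
  "Pow {..<Suc n} = image Suc ` Pow {..<n} \<union> (\<lambda>T. insert 0 (Suc ` T)) ` Pow {..<n}" (is "?L = ?A \<union> ?B")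
proof (intro set_eqI iffI)
  fix S assume S: "S \<in> ?L"
  define T where "T = {j. Suc j \<in> S}"
  have T: "T \<in> Pow {..<n}" using S by (auto simp: T_def)
  have "S = (if 0 \<in> S then insert 0 (Suc ` T) else Suc ` T)"
  proof (rule set_eqI)
    fix j show "j \<in> S \<longleftrightarrow> j \<in> (if 0 \<in> S then insert 0 (Suc ` T) else Suc ` T)"
      by (cases j) (auto simp: T_def)
  qed
  then show "S \<in> ?A \<union> ?B" using T by (auto split: if_splits)
qed auto

lemma wedge_Nil: "(\<alpha> \<^bold>\<and> \<beta>) [] = \<alpha> [] * \<beta> []"
  by (simp add: wedge_def shuffle_sign_def)

lemma wedge_Cons:
  "(\<alpha> \<^bold>\<and> \<beta>) (x # xs) =
     (interior x \<alpha> \<^bold>\<and> \<beta>) xs + ((\<lambda>ys. (- 1) ^ length ys * \<alpha> ys) \<^bold>\<and> interior x \<beta>) xs"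
proof -
  define n where "n = length xs"
  define g where "g S = shuffle_sign (Suc n) S * \<alpha> (nths (x # xs) S) * \<beta> (nths (x # xs) (- S))" for S
  have inj: "inj_on (image Suc) (Pow {..<n})" "inj_on (\<lambda>T. insert 0 (Suc ` T)) (Pow {..<n})"
    by (auto simp: inj_on_def inj_image_eq_iff insert_eq_iff)
  have "(\<alpha> \<^bold>\<and> \<beta>) (x # xs) = sum g (Pow {..<Suc n})"
    by (simp add: wedge_def g_def n_def)
  also have "\<dots> = sum g (image Suc ` Pow {..<n}) + sum g ((\<lambda>T. insert 0 (Suc ` T)) ` Pow {..<n})"
    unfolding Pow_lessThan_Suc_shift by (rule sum.union_disjoint) auto
  also have "sum g (image Suc ` Pow {..<n}) = (\<Sum>T\<in>Pow {..<n}. g (Suc ` T))"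
    using inj(1) by (simp add: sum.reindex)
  also have "\<dots> = ((\<lambda>ys. (- 1) ^ length ys * \<alpha> ys) \<^bold>\<and> interior x \<beta>) xs"
    unfolding wedge_def n_def[symmetric]
  proof (rule sum.cong[OF refl])
    fix T assume T: "T \<in> Pow {..<n}"
    have "{i. i < length xs \<and> i \<in> T} = T" using T by (auto simp: n_def)
    then have len: "length (nths xs T) = card T" by (simp add: length_nths)
    have *: "{j. Suc j \<in> Suc ` T} = T" "{j. Suc j \<notin> Suc ` T} = - T" by auto
    show "g (Suc ` T) = shuffle_sign n T * ((- 1) ^ length (nths xs T) * \<alpha> (nths xs T))
        * interior x \<beta> (nths xs (- T))"
      using T by (simp add: g_def nths_Cons len shuffle_sign_Suc_image interior_def *)
  qed
  also have "sum g ((\<lambda>T. insert 0 (Suc ` T)) ` Pow {..<n}) = (\<Sum>T\<in>Pow {..<n}. g (insert 0 (Suc ` T)))"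
    using inj(2) by (simp add: sum.reindex)
  also have "\<dots> = (interior x \<alpha> \<^bold>\<and> \<beta>) xs"
    unfolding wedge_def n_def[symmetric]
  proof (rule sum.cong[OF refl])
    fix T assume T: "T \<in> Pow {..<n}"
    have *: "{j. Suc j \<in> Suc ` T} = T" "{j. Suc j \<notin> Suc ` T} = - T" by auto
    show "g (insert 0 (Suc ` T)) = shuffle_sign n T * interior x \<alpha> (nths xs T) * \<beta> (nths xs (- T))"
      using T by (simp add: g_def nths_Cons shuffle_sign_insert_0 interior_def *)
  qed
  finally show ?thesis by simp
qed

lemma forms_length: "\<alpha> \<in> forms k \<Longrightarrow> length xs \<noteq> k \<Longrightarrow> \<alpha> xs = 0"
  by (simp add: forms_def)

lemma forms_linear: "\<alpha> \<in> forms k \<Longrightarrow> length xs = k \<Longrightarrow> i < k \<Longrightarrow> linear (\<lambda>x. \<alpha> (xs[i := x]))"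
  by (simp add: forms_def)

lemma forms_eq_args: "\<alpha> \<in> forms k \<Longrightarrow> length xs = k \<Longrightarrow> i < j \<Longrightarrow> j < k \<Longrightarrow> xs ! i = xs ! j \<Longrightarrow> \<alpha> xs = 0"
  unfolding forms_def by blast

lemma subspace_forms: "subspace (forms k)"
proof -
  have z: "0 \<in> forms k"
    unfolding forms_def by (simp add: module_hom_zero zero_fun_def)
  have p: "\<alpha> + \<beta> \<in> forms k" if "\<alpha> \<in> forms k" "\<beta> \<in> forms k" for \<alpha> \<beta> :: "'a form"
    using that unfolding forms_def by (auto simp: linear_compose_add)
  have scale: "linear (\<lambda>x. c * f x)" if "linear f" for c and f :: "'a \<Rightarrow> real"
    using linear_compose_scale_right[OF that, of c] by simp
  have s: "c *\<^sub>R \<alpha> \<in> forms k" if "\<alpha> \<in> forms k" for c and \<alpha> :: "'a form"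
    using that unfolding forms_def by (auto intro: scale)
  show ?thesis unfolding subspace_def using z p s by auto
qed

text \<open>
  Only the first argument and equality of the first two arguments have to be checked, because
  antisymmetry in the first two moves every later argument to a place where the contraction,
  which is a form of lower degree, controls it. This allows induction on the degree.
\<close>

lemma forms_Suc_iff:
  "\<gamma> \<in> forms (Suc n) \<longleftrightarrow> \<gamma> [] = 0 \<and> (\<forall>x. interior x \<gamma> \<in> forms n) \<and>
     linear (\<lambda>x. interior x \<gamma>) \<and> (\<forall>x. interior x (interior x \<gamma>) = 0)" (is "?L \<longleftrightarrow> ?R")
proof
  assume L: ?L
  have "interior x \<gamma> \<in> forms n" for x
    unfolding forms_def
  proof (clarsimp, safe)
    fix xs :: "'a list" assume "length xs \<noteq> n"
    then show "interior x \<gamma> xs = 0" using forms_length[OF L, of "x # xs"] by (simp add: interior_def)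
  next
    fix xs :: "'a list" and i assume "i < length xs" "n = length xs"
    then show "linear (\<lambda>y. interior x \<gamma> (xs[i := y]))"
      using forms_linear[OF L, of "x # xs" "Suc i"] by (simp add: interior_def)
  next
    fix xs :: "'a list" and i j
    assume "i < j" "j < length xs" "xs ! i = xs ! j" "n = length xs"
    then show "interior x \<gamma> xs = 0"
      using forms_eq_args[OF L, of "x # xs" "Suc i" "Suc j"] by (simp add: interior_def)
  qed
  moreover have "linear (\<lambda>x. interior x \<gamma>)"
  proof -
    have *: "linear (\<lambda>x. \<gamma> (x # xs))" for xs
    proof (cases "length xs = n")
      case True then show ?thesis using forms_linear[OF L, of "undefined # xs" 0] by simp
    next
      case False
      then have "\<gamma> (x # xs) = 0" for x using forms_length[OF L, of "x # xs"] by simp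
      then show ?thesis by (simp add: module_hom_zero)
    qed
    show ?thesis
      by (rule linearI) (auto simp: interior_def fun_eq_iff linear_add[OF *] linear_scale[OF *])
  qed
  moreover have "interior x (interior x \<gamma>) = 0" for x
  proof
    fix xs show "interior x (interior x \<gamma>) xs = 0 xs"
      using forms_length[OF L, of "x # x # xs"] forms_eq_args[OF L, of "x # x # xs" 0 1]
      by (cases "length (x # x # xs) = Suc n") (auto simp: interior_def)
  qed
  ultimately show ?R using forms_length[OF L, of "[]"] by auto
next
  assume R: ?R
  then have I: "interior x \<gamma> \<in> forms n" for x by blast
  have lin: "linear (\<lambda>x. \<gamma> (x # xs))" for xs
  proof -
    have "linear (\<lambda>x. interior x \<gamma>)" using R by blast
    then show ?thesis
      by (auto simp: linear_iff interior_def fun_eq_iff)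
  qed
  have alt: "\<gamma> (x # x # xs) = 0" for x xs
    using R by (auto simp: interior_def fun_eq_iff)
  have sw: "\<gamma> (x # y # xs) = - \<gamma> (y # x # xs)" for x y xs
  proof -
    have l2: "linear (\<lambda>y. \<gamma> (x # y # xs))" for x
    proof (cases "Suc (length xs) = n")
      case True
      then show ?thesis using forms_linear[OF I[of x], of "undefined # xs" 0] by (auto simp: interior_def)
    next
      case False
      then have "\<gamma> (x # y # xs) = 0" for y using forms_length[OF I[of x], of "y # xs"] by (simp add: interior_def)
      then show ?thesis by (simp add: module_hom_zero)
    qed
    have "\<gamma> ((x + y) # (x + y) # xs) = \<gamma> (x # (x + y) # xs) + \<gamma> (y # (x + y) # xs)"
      by (rule linear_add[OF lin])
    note first = this
    have second: "\<gamma> (z # (x + y) # xs) = \<gamma> (z # x # xs) + \<gamma> (z # y # xs)" for z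
      by (rule linear_add[OF l2])
    show ?thesis
      using first second[of x] second[of y] alt[of x xs] alt[of y xs] alt[of "x + y" xs] by linarith
  qed
  show ?L unfolding forms_def
  proof (clarsimp, safe)
    fix xs :: "'a list" assume "length xs \<noteq> Suc n"
    then show "\<gamma> xs = 0"
      using R by (cases xs) (auto dest: forms_length[OF I] simp: interior_def)
  next
    fix xs :: "'a list" and i assume a: "i < Suc n" "length xs = Suc n"
    then obtain x ys where xs: "xs = x # ys" "length ys = n" by (cases xs) auto
    show "linear (\<lambda>y. \<gamma> (xs[i := y]))"
    proof (cases i)
      case 0 then show ?thesis using lin xs by simp
    next
      case (Suc j) then show ?thesis using forms_linear[OF I[of x] xs(2), of j] a xs by (simp add: interior_def)
    qed
  next
    fix xs :: "'a list" and i j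
    assume a: "i < j" "j < Suc n" "xs ! i = xs ! j" "length xs = Suc n"
    then obtain x ys where xs: "xs = x # ys" "length ys = n" by (cases xs) auto
    obtain j' where j: "j = Suc j'" using a(1) by (cases j) auto
    show "\<gamma> xs = 0"
    proof (cases i)
      case (Suc i')
      then show ?thesis using forms_eq_args[OF I[of x] xs(2), of i' j'] a xs j by (simp add: interior_def)
    next
      case 0
      show ?thesis
      proof (cases j')
        case 0 then show ?thesis using a xs j \<open>i = 0\<close> alt by (cases ys) auto
      next
        case (Suc k)
        obtain y zs where ys: "ys = y # zs" using a xs j Suc by (cases ys) auto
        have "\<gamma> (y # x # zs) = 0"
          using forms_eq_args[OF I[of y], of "x # zs" 0 j'] a xs j Suc ys \<open>i = 0\<close> by (simp add: interior_def)
        then show ?thesis using sw[of x y zs] xs ys by simp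
      qed
    qed
  qed
qed

lemma forms_0_iff: "\<gamma> \<in> forms 0 \<longleftrightarrow> (\<forall>x. interior x \<gamma> = 0)"
proof -
  have "(\<forall>x. interior x \<gamma> = 0) \<longleftrightarrow> (\<forall>xs. xs \<noteq> [] \<longrightarrow> \<gamma> xs = 0)"
    by (auto simp: interior_def fun_eq_iff neq_Nil_conv)
  then show ?thesis by (auto simp: forms_def)
qed

lemma interior_0 [simp]: "interior x 0 = 0" by (simp add: interior_def fun_eq_iff)
lemma interior_diff: "interior x (\<alpha> - \<beta>) = interior x \<alpha> - interior x \<beta>" by (simp add: interior_def fun_eq_iff)
lemma interior_scaleR: "interior x (c *\<^sub>R \<beta>) = c *\<^sub>R interior x \<beta>" by (simp add: interior_def fun_eq_iff)

lemma wedge_add_left: "(\<alpha> + \<beta>) \<^bold>\<and> \<gamma> = \<alpha> \<^bold>\<and> \<gamma> + \<beta> \<^bold>\<and> \<gamma>"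
  by (simp add: wedge_def fun_eq_iff algebra_simps sum.distrib)
lemma wedge_add_right: "\<gamma> \<^bold>\<and> (\<alpha> + \<beta>) = \<gamma> \<^bold>\<and> \<alpha> + \<gamma> \<^bold>\<and> \<beta>"
  by (simp add: wedge_def fun_eq_iff algebra_simps sum.distrib)
lemma wedge_scaleR_left: "(c *\<^sub>R \<alpha>) \<^bold>\<and> \<gamma> = c *\<^sub>R (\<alpha> \<^bold>\<and> \<gamma>)"
  by (simp add: wedge_def fun_eq_iff algebra_simps sum_distrib_left)
lemma wedge_scaleR_right: "\<gamma> \<^bold>\<and> (c *\<^sub>R \<alpha>) = c *\<^sub>R (\<gamma> \<^bold>\<and> \<alpha>)"
  by (simp add: wedge_def fun_eq_iff algebra_simps sum_distrib_left)
lemma wedge_0_left [simp]: "0 \<^bold>\<and> \<gamma> = 0" by (simp add: wedge_def fun_eq_iff)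
lemma wedge_0_right [simp]: "\<gamma> \<^bold>\<and> 0 = 0" by (simp add: wedge_def fun_eq_iff)

text \<open>Contraction is an antiderivation; this is \<open>wedge_Cons\<close> for a form of known degree.\<close>

lemma interior_wedge:
  assumes "\<alpha> \<in> forms p"
  shows "interior x (\<alpha> \<^bold>\<and> \<beta>) = interior x \<alpha> \<^bold>\<and> \<beta> + (- 1) ^ p *\<^sub>R (\<alpha> \<^bold>\<and> interior x \<beta>)"
proof -
  have sign: "(\<lambda>ys. (- 1) ^ length ys * \<alpha> ys) = (- 1) ^ p *\<^sub>R \<alpha>"
  proof
    fix ys show "(- 1) ^ length ys * \<alpha> ys = ((- 1) ^ p *\<^sub>R \<alpha>) ys"
      using forms_length[OF assms, of ys] by (cases "length ys = p") auto
  qed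
  have "interior x (\<alpha> \<^bold>\<and> \<beta>) xs =
      (interior x \<alpha> \<^bold>\<and> \<beta> + (- 1) ^ p *\<^sub>R (\<alpha> \<^bold>\<and> interior x \<beta>)) xs" for xs
    unfolding interior_def[of x "\<alpha> \<^bold>\<and> \<beta>"] wedge_Cons sign wedge_scaleR_left plus_fun_apply ..
  then show ?thesis by (rule ext)
qed

text \<open>
  By induction on the total degree: contracting \<open>\<alpha> \<^bold>\<and> \<beta>\<close> twice with the same vector gives two mixed
  terms of opposite signs.
\<close>

lemma wedge_forms:
  assumes "\<alpha> \<in> forms p" "\<beta> \<in> forms q"
  shows "\<alpha> \<^bold>\<and> \<beta> \<in> forms (p + q)"
  using assms
proof (induction "p + q" arbitrary: p q \<alpha> \<beta>)
  case 0
  then show ?case by (simp add: forms_0_iff interior_wedge[of _ 0])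
next
  case (Suc n)
  note add = subspace_add[OF subspace_forms] and scale = subspace_scale[OF subspace_forms]
  have left: "interior x \<alpha> \<^bold>\<and> \<beta> \<in> forms n" for x
  proof (cases p)
    case 0 then show ?thesis using Suc.prems(1) subspace_0[OF subspace_forms] by (simp add: forms_0_iff)
  next
    case (Suc p')
    then show ?thesis using Suc.hyps Suc.prems by (auto simp: forms_Suc_iff)
  qed
  have right: "\<alpha> \<^bold>\<and> interior x \<beta> \<in> forms n" for x
  proof (cases q)
    case 0 then show ?thesis using Suc.prems(2) subspace_0[OF subspace_forms] by (simp add: forms_0_iff)
  next
    case (Suc q')
    then show ?thesis using Suc.hyps Suc.prems by (auto simp: forms_Suc_iff)
  qed
  have lin: "linear (\<lambda>x. interior x \<gamma>)" "interior x (interior x \<gamma>) = 0" if "\<gamma> \<in> forms k" for \<gamma> :: "'a form" and k x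
    using that by (cases k; auto simp: forms_Suc_iff forms_0_iff module_hom_zero)+
  have "linear (\<lambda>x. interior x (\<alpha> \<^bold>\<and> \<beta>))"
    by (rule linearI) (simp_all add: interior_wedge[OF Suc.prems(1)] wedge_add_left wedge_add_right
        wedge_scaleR_left wedge_scaleR_right algebra_simps
        linear_add[OF lin(1)[OF Suc.prems(1)]] linear_add[OF lin(1)[OF Suc.prems(2)]]
        linear_scale[OF lin(1)[OF Suc.prems(1)]] linear_scale[OF lin(1)[OF Suc.prems(2)]])
  moreover have "interior x (interior x (\<alpha> \<^bold>\<and> \<beta>)) = 0" for x
  proof (cases p)
    case 0
    then have "interior x \<alpha> = 0" using Suc.prems(1) by (simp add: forms_0_iff)
    then show ?thesis
      by (simp add: interior_wedge[OF Suc.prems(1)] interior_scaleR lin(2)[OF Suc.prems(2)])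
  next
    case (Suc p')
    then have "interior x \<alpha> \<in> forms p'" using Suc.prems(1) by (simp add: forms_Suc_iff)
    then show ?thesis
      using Suc by (simp add: interior_wedge[OF Suc.prems(1)] interior_wedge[of "interior x \<alpha>"] interior_diff
        interior_scaleR lin(2)[OF Suc.prems(1)] lin(2)[OF Suc.prems(2)])
  qed
  moreover have "(\<alpha> \<^bold>\<and> \<beta>) [] = 0"
    using Suc.hyps(2) forms_length[OF Suc.prems(1), of "[]"] forms_length[OF Suc.prems(2), of "[]"]
    by (cases p) (auto simp: wedge_Nil)
  moreover have "interior x (\<alpha> \<^bold>\<and> \<beta>) \<in> forms n" for x
    unfolding interior_wedge[OF Suc.prems(1)] by (intro add scale left right)
  ultimately have "\<alpha> \<^bold>\<and> \<beta> \<in> forms (Suc n)"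
    unfolding forms_Suc_iff by blast
  then show ?case using Suc.hyps(2) by simp
qed

lemma interior_forms: "\<gamma> \<in> forms (Suc n) \<Longrightarrow> interior x \<gamma> \<in> forms n"
  by (simp add: forms_Suc_iff)

lemma form_1_linear: "\<alpha> \<in> forms 1 \<Longrightarrow> linear (\<lambda>x. \<alpha> [x])"
  using forms_linear[of \<alpha> 1 "[undefined]" 0] by simp

lemma form_2_linear_left: "\<alpha> \<in> forms 2 \<Longrightarrow> linear (\<lambda>x. \<alpha> [x, y])"
  using forms_linear[of \<alpha> 2 "[undefined, y]" 0] by simp

lemma form_2_linear_right: "\<alpha> \<in> forms 2 \<Longrightarrow> linear (\<lambda>y. \<alpha> [x, y])"
  using forms_linear[of \<alpha> 2 "[x, undefined]" 1] by simp

lemma form_2_alternating: "\<alpha> \<in> forms 2 \<Longrightarrow> \<alpha> [x, x] = 0"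
  using forms_eq_args[of \<alpha> 2 "[x, x]" 0 1] by simp

lemma form_2_antisym:
  assumes "\<alpha> \<in> forms 2"
  shows "\<alpha> [y, x] = - \<alpha> [x, y]"
proof -
  have "0 = \<alpha> [x + y, x + y]" by (rule form_2_alternating[OF assms, symmetric])
  also have "\<dots> = \<alpha> [x, x] + \<alpha> [x, y] + (\<alpha> [y, x] + \<alpha> [y, y])"
    by (simp only: linear_add[OF form_2_linear_left[OF assms]] linear_add[OF form_2_linear_right[OF assms]])
  finally show ?thesis by (simp add: form_2_alternating[OF assms])
qed

lemmas form_1_simps = form_1_linear[THEN linear_add] form_1_linear[THEN linear_diff] form_1_linear[THEN linear_scale]
  form_1_linear[THEN linear_0] form_1_linear[THEN linear_neg]
lemmas form_2_simps =
  form_2_linear_left[THEN linear_add] form_2_linear_right[THEN linear_add]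
  form_2_linear_left[THEN linear_diff] form_2_linear_right[THEN linear_diff]
  form_2_linear_left[THEN linear_scale] form_2_linear_right[THEN linear_scale]
  form_2_linear_left[THEN linear_neg] form_2_linear_right[THEN linear_neg]
  form_2_linear_left[THEN linear_0] form_2_linear_right[THEN linear_0]
  form_2_alternating

lemma wedge_1_1:
  assumes "\<alpha> \<in> forms 1" "\<beta> \<in> forms 1"
  shows "(\<alpha> \<^bold>\<and> \<beta>) [x, y] = \<alpha> [x] * \<beta> [y] - \<alpha> [y] * \<beta> [x]"
  by (simp add: wedge_Cons wedge_Nil interior_def forms_length[OF assms(1)] forms_length[OF assms(2)])

lemma wedge_1_2:
  assumes "\<alpha> \<in> forms 1" "\<beta> \<in> forms 2"
  shows "(\<alpha> \<^bold>\<and> \<beta>) [x, y, z] = \<alpha> [x] * \<beta> [y, z] - \<alpha> [y] * \<beta> [x, z] + \<alpha> [z] * \<beta> [x, y]"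
  by (simp add: wedge_Cons wedge_Nil interior_def forms_length[OF assms(1)] forms_length[OF assms(2)])

lemma wedge_2_2:
  assumes "\<alpha> \<in> forms 2" "\<beta> \<in> forms 2"
  shows "(\<alpha> \<^bold>\<and> \<beta>) [w, x, y, z] =
     \<alpha> [w, x] * \<beta> [y, z] - \<alpha> [w, y] * \<beta> [x, z] + \<alpha> [w, z] * \<beta> [x, y]
   + \<alpha> [y, z] * \<beta> [w, x] - \<alpha> [x, z] * \<beta> [w, y] + \<alpha> [x, y] * \<beta> [w, z]"
  by (simp add: wedge_Cons wedge_Nil interior_def forms_length[OF assms(1)] forms_length[OF assms(2)])

lemma wedge_4_1:
  assumes "\<alpha> \<in> forms 4" "\<beta> \<in> forms 1"
  shows "(\<alpha> \<^bold>\<and> \<beta>) [u, w, x, y, z] =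
     \<alpha> [u, w, x, y] * \<beta> [z] - \<alpha> [u, w, x, z] * \<beta> [y] + \<alpha> [u, w, y, z] * \<beta> [x]
   - \<alpha> [u, x, y, z] * \<beta> [w] + \<alpha> [w, x, y, z] * \<beta> [u]"
  by (simp add: wedge_Cons wedge_Nil interior_def forms_length[OF assms(1)] forms_length[OF assms(2)])

lemma ce_diff_2: "ce_diff br \<alpha> [x, y] = - \<alpha> [br x y]"
proof -
  have "{(i, j). i < j \<and> j < length [x, y]} = {(0, 1)}" by auto
  then show ?thesis by (simp add: ce_diff_def nths_Cons)
qed

lemma ce_diff_3: "ce_diff br \<alpha> [x, y, z] = - \<alpha> [br x y, z] + \<alpha> [br x z, y] - \<alpha> [br y z, x]"
proof -
  have "{(i, j). i < j \<and> j < length [x, y, z]} = {(0, 1), (0, 2), (1, 2)}" by auto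
  then show ?thesis by (simp add: ce_diff_def nths_Cons numeral_2_eq_2)
qed

lemma ce_diff_4: "ce_diff br \<alpha> [w, x, y, z] =
    - \<alpha> [br w x, y, z] + \<alpha> [br w y, x, z] - \<alpha> [br w z, x, y]
    - \<alpha> [br x y, w, z] + \<alpha> [br x z, w, y] - \<alpha> [br y z, w, x]"
proof -
  have "{(i, j). i < j \<and> j < length [w, x, y, z]} = {(0, 1), (0, 2), (0, 3), (1, 2), (1, 3), (2, 3)}" by auto
  then show ?thesis by (simp add: ce_diff_def nths_Cons numeral_2_eq_2 numeral_3_eq_3)
qed

lemma forms_1_eqI:
  assumes "\<alpha> \<in> forms 1" "\<beta> \<in> forms 1" "span B = UNIV" "\<And>x. x \<in> B \<Longrightarrow> \<alpha> [x] = \<beta> [x]"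
  shows "\<alpha> = \<beta>"
proof
  fix xs
  have "\<alpha> [x] = \<beta> [x]" for x
    using linear_eq_on_span[OF form_1_linear[OF assms(1)] form_1_linear[OF assms(2)], of B] assms by auto
  then show "\<alpha> xs = \<beta> xs"
    using forms_length[OF assms(1), of xs] forms_length[OF assms(2), of xs]
    by (cases "length xs = 1") (auto simp: length_Suc_conv)
qed

lemma forms_2_eqI:
  assumes "\<alpha> \<in> forms 2" "\<beta> \<in> forms 2" "span B = UNIV"
    and "\<And>x y. x \<in> B \<Longrightarrow> y \<in> B \<Longrightarrow> \<alpha> [x, y] = \<beta> [x, y]"
  shows "\<alpha> = \<beta>"
proof
  fix xs
  have "\<alpha> [x, y] = \<beta> [x, y]" if "x \<in> B" for x y
    using linear_eq_on_span[OF form_2_linear_right[OF assms(1)] form_2_linear_right[OF assms(2)], of B x x] assms that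
    by auto
  then have "\<alpha> [x, y] = \<beta> [x, y]" for x y
    using linear_eq_on_span[OF form_2_linear_left[OF assms(1)] form_2_linear_left[OF assms(2)], of B y y] assms
    by auto
  then show "\<alpha> xs = \<beta> xs"
    using forms_length[OF assms(1), of xs] forms_length[OF assms(2), of xs]
    by (cases "length xs = 2") (auto simp: length_Suc_conv numeral_2_eq_2)
qed

section \<open>Bases adapted to an SU(2)-structure\<close>

text \<open>
  A vector in the span of the other arguments may be replaced by them one at a time, and then an
  argument is repeated.
\<close>

lemma forms_independent:
  assumes "\<alpha> \<in> forms n" "\<alpha> xs \<noteq> 0"
  shows "distinct xs \<and> independent (set xs)"
proof -
  have len: "length xs = n" using forms_length assms by blast
  have d: "distinct xs"
    unfolding distinct_conv_nth
  proof (intro allI impI)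
    fix i j assume "i < length xs" "j < length xs" "i \<noteq> j"
    then show "xs ! i \<noteq> xs ! j"
      using forms_eq_args[OF assms(1) len, of i j] forms_eq_args[OF assms(1) len, of j i] assms(2) len
      by (metis linorder_neqE_nat)
  qed
  have "independent (set xs)"
  proof
    assume "dependent (set xs)"
    then obtain x where x: "x \<in> set xs" "x \<in> span (set xs - {x})" by (auto simp: dependent_def)
    then obtain i where i: "i < length xs" "x = xs ! i" by (auto simp: in_set_conv_nth)
    have "\<alpha> (xs[i := x]) = 0"
    proof (rule linear_eq_0_on_span[where f = "\<lambda>x. \<alpha> (xs[i := x])", OF _ _ x(2)])
      show "linear (\<lambda>x. \<alpha> (xs[i := x]))" using forms_linear[OF assms(1) len] i len by simp
      fix y assume "y \<in> set xs - {x}"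
      then obtain j where j: "j < length xs" "y = xs ! j" "i \<noteq> j" using i by (auto simp: in_set_conv_nth)
      have "length (xs[i := y]) = n" using len by simp
      then show "\<alpha> (xs[i := y]) = 0"
        using forms_eq_args[OF assms(1), of "xs[i := y]" i j] forms_eq_args[OF assms(1), of "xs[i := y]" j i] i j len
        by (metis linorder_neqE_nat nth_list_update_eq nth_list_update_neq)
    qed
    then show False using i assms(2) by simp
  qed
  with d show ?thesis by simp
qed

lemma independent_spans:
  fixes S :: "'a::real_vector set"
  assumes "independent S" "card S = dim (UNIV :: 'a set)" "card S > 0"
  shows "span S = UNIV"
proof -
  obtain B where B: "S \<subseteq> B" "independent B" "UNIV \<subseteq> span B"
    using maximal_independent_subset_extend[of S UNIV] assms(1) by auto
  then have "card B = dim (UNIV :: 'a set)"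
    using dim_eq_card[of B UNIV] by (simp add: top.extremum_unique)
  then have "finite B" using assms(2,3) by (simp add: card_ge_0_finite)
  then have "S = B" using B(1) assms(2) \<open>card B = _\<close> by (simp add: card_subset_eq)
  then show ?thesis using B by auto
qed

lemma dual_functionals_independent:
  assumes "finite I" "\<And>i. i \<in> I \<Longrightarrow> linear (f i)"
    and "\<And>i j. i \<in> I \<Longrightarrow> j \<in> I \<Longrightarrow> f i (b j) = (if i = j then 1 else 0 :: real)"
  shows "inj_on b I \<and> independent (b ` I)"
proof -
  have inj: "inj_on b I"
  proof (rule inj_onI)
    fix i j assume "i \<in> I" "j \<in> I" "b i = b j"
    then show "i = j" using assms(3)[of i i] assms(3)[of i j] by (auto split: if_splits)
  qed
  have "independent (b ` I)"
  proof
    assume "dependent (b ` I)"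
    then obtain i where i: "i \<in> I" "b i \<in> span (b ` I - {b i})" by (auto simp: dependent_def)
    have "f i (b i) = 0"
      by (rule linear_eq_0_on_span[OF assms(2)[OF i(1)] _ i(2)]) (use assms(3) i in auto)
    then show False using assms(3) i by simp
  qed
  with inj show ?thesis by simp
qed

text \<open>
  If the components of \<open>\<Phi>\<close> are linearly independent functionals, they have a dual system of vectors.
\<close>

lemma linear_surjI:
  fixes \<Phi> :: "'a::real_vector \<Rightarrow> 'b::euclidean_space"
  assumes "linear \<Phi>" "\<And>u. (\<And>y. u \<bullet> \<Phi> y = 0) \<Longrightarrow> u = 0"
  shows "surj \<Phi>"
proof (rule ccontr)
  assume not_surj: "\<not> surj \<Phi>"
  have sp: "span (range \<Phi>) = range \<Phi>"
    using linear_subspace_image[OF assms(1) subspace_UNIV] by (simp add: span_eq_iff)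
  have "span (range \<Phi>) \<noteq> UNIV" unfolding sp using not_surj .
  then obtain u where "u \<noteq> 0" "\<forall>x\<in>span (range \<Phi>). u \<bullet> x = 0"
    using span_not_UNIV_orthogonal[of "range \<Phi>"] by auto
  then have "u \<bullet> \<Phi> y = 0" for y using span_base[of "\<Phi> y" "range \<Phi>"] by simp
  then have "u = 0" by (rule assms(2))
  with \<open>u \<noteq> 0\<close> show False by simp
qed

text \<open>The components of \<open>e\<^sup>p \<and> e\<^sup>q\<close>.\<close>

definition coord_2form :: "nat \<Rightarrow> nat \<Rightarrow> nat \<Rightarrow> nat \<Rightarrow> real" where
  "coord_2form p q i j = of_bool (i = p) * of_bool (j = q) - of_bool (i = q) * of_bool (j = p)"

text \<open>
  The components of the model forms \<open>e\<^sup>1\<^sup>2 + e\<^sup>3\<^sup>4\<close>, \<open>e\<^sup>1\<^sup>3 + e\<^sup>4\<^sup>2\<close> and \<open>e\<^sup>1\<^sup>4 + e\<^sup>2\<^sup>3\<close>.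
\<close>

definition std_omega :: "nat \<Rightarrow> nat \<Rightarrow> nat \<Rightarrow> real" where
  "std_omega k i j =
     (if k = 1 then coord_2form 1 2 i j + coord_2form 3 4 i j
      else if k = 2 then coord_2form 1 3 i j + coord_2form 4 2 i j
      else coord_2form 1 4 i j + coord_2form 2 3 i j)"

lemma std_omega_antisym: "std_omega k j i = - std_omega k i j"
  by (simp add: std_omega_def coord_2form_def)

lemmas std_omega_eval = std_omega_def coord_2form_def

definition adapted_basis :: "'a::real_vector form \<Rightarrow> (nat \<Rightarrow> 'a form) \<Rightarrow> (nat \<Rightarrow> 'a) \<Rightarrow> bool" where
  "adapted_basis \<eta> \<omega> b \<longleftrightarrow>
     span (b ` {1..5}) = UNIV \<and>
     (\<forall>i\<in>{1..5}. \<eta> [b i] = (if i = 5 then 1 else 0)) \<and>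
     (\<forall>k\<in>{1..3}. \<forall>i\<in>{1..5}. \<forall>j\<in>{1..5}. \<omega> k [b i, b j] = std_omega k i j)"

lemma atLeastAtMost_1_5: "{1..5} = {1, 2, 3, 4, 5 :: nat}"
  and atLeastAtMost_1_3: "{1..3} = {1, 2, 3 :: nat}"
  by auto

lemma interior_form_2: "\<alpha> \<in> forms 2 \<Longrightarrow> interior x \<alpha> \<in> forms 1"
  by (simp add: numeral_2_eq_2 interior_forms)

text \<open>Indices of bases and of the \<open>\<omega> k\<close> are numerals throughout, so \<open>1\<close> must not become \<open>Suc 0\<close>.\<close>

declare One_nat_def [simp del]

text \<open>
  For an adapted basis the contractions of the forms with \<open>b 1\<close> and \<open>b 2\<close> are already the dual coframe,
  so no coordinates have to be chosen to define it.
\<close>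

definition dual_coframe :: "'a::real_vector form \<Rightarrow> (nat \<Rightarrow> 'a form) \<Rightarrow> (nat \<Rightarrow> 'a) \<Rightarrow> nat \<Rightarrow> 'a form" where
  "dual_coframe \<eta> \<omega> b k =
     (if k = 1 then - interior (b 2) (\<omega> 1) else if k = 2 then interior (b 1) (\<omega> 1)
      else if k = 3 then interior (b 1) (\<omega> 2) else if k = 4 then interior (b 1) (\<omega> 3) else \<eta>)"

lemma dual_coframe_forms:
  assumes "\<eta> \<in> forms 1" "\<And>k. k \<in> {1..3} \<Longrightarrow> \<omega> k \<in> forms 2"
  shows "dual_coframe \<eta> \<omega> b k \<in> forms 1"
  using assms(1) interior_form_2[OF assms(2)]
  by (simp add: dual_coframe_def subspace_neg[OF subspace_forms])

lemma dual_coframe_spans: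
  fixes b :: "nat \<Rightarrow> 'a::real_vector"
  assumes dim: "dim (UNIV :: 'a set) = 5"
    and "\<eta> \<in> forms 1" "\<And>k. k \<in> {1..3} \<Longrightarrow> \<omega> k \<in> forms 2"
    and dual: "\<And>i j. i \<in> {1..5} \<Longrightarrow> j \<in> {1..5} \<Longrightarrow> dual_coframe \<eta> \<omega> b i [b j] = (if i = j then 1 else 0)"
  shows "span (b ` {1..5}) = UNIV"
proof -
  have "inj_on b {1..5} \<and> independent (b ` {1..5})"
    by (rule dual_functionals_independent[where f = "\<lambda>i x. dual_coframe \<eta> \<omega> b i [x]"])
      (simp_all only: finite_atLeastAtMost form_1_linear[OF dual_coframe_forms] assms)
  then show ?thesis
    using independent_spans[of "b ` {1..5}"] dim by (simp add: card_image)
qed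

lemma adapted_basisI:
  fixes b :: "nat \<Rightarrow> 'a::real_vector"
  assumes dim: "dim (UNIV :: 'a set) = 5"
    and \<eta>: "\<eta> \<in> forms 1" and \<omega>: "\<And>k. k \<in> {1..3} \<Longrightarrow> \<omega> k \<in> forms 2"
    and \<eta>_b: "\<And>i. i \<in> {1..5} \<Longrightarrow> \<eta> [b i] = (if i = 5 then 1 else 0)"
    and \<omega>_b: "\<And>k i j. k \<in> {1..3} \<Longrightarrow> i \<in> {1..5} \<Longrightarrow> j \<in> {1..5} \<Longrightarrow> i < j \<Longrightarrow>
           \<omega> k [b i, b j] = std_omega k i j"
  shows "adapted_basis \<eta> \<omega> b"
proof -
  have all: "\<omega> k [b i, b j] = std_omega k i j" if "k \<in> {1..3}" "i \<in> {1..5}" "j \<in> {1..5}" for k i j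
  proof (cases i j rule: linorder_cases)
    case less then show ?thesis using \<omega>_b that by blast
  next
    case equal
    then show ?thesis using form_2_alternating[OF \<omega>] that std_omega_antisym[of k j j] by simp
  next
    case greater
    then show ?thesis
      using form_2_antisym[OF \<omega>[OF that(1)], of "b i" "b j"] \<omega>_b[OF that(1,3,2)]
        std_omega_antisym[of k i j] by simp
  qed
  have dual: "dual_coframe \<eta> \<omega> b i [b j] = (if i = j then 1 else 0)" if "i \<in> {1..5}" "j \<in> {1..5}" for i j
    using that unfolding atLeastAtMost_1_5
    by (elim insertE emptyE) (simp_all add: dual_coframe_def interior_def all std_omega_eval \<eta>_b)
  have "span (b ` {1..5}) = UNIV"
    by (rule dual_coframe_spans[OF dim \<eta> \<omega> dual])
  then show ?thesis unfolding adapted_basis_def using all \<eta>_b by auto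
qed

text \<open>
  Up to scale, \<open>\<xi>\<close> is the vector with \<open>v = i\<^sub>\<xi> vol\<close>, written in a basis. The components of
  \<open>v = \<omega>\<^sub>k \<and> \<omega>\<^sub>k\<close> are twice the sub-Pfaffians of \<open>\<omega>\<^sub>k\<close>, and for a skew form of odd size the vector of
  signed sub-Pfaffians lies in the kernel; hence all \<open>\<omega>\<^sub>k\<close> with the same square annihilate \<open>\<xi>\<close>.
\<close>

lemma ex_reeb_vector:
  fixes \<eta> :: "'a::real_vector form"
  assumes dim: "dim (UNIV :: 'a set) = 5"
    and \<eta>: "\<eta> \<in> forms 1" and \<omega>: "\<And>k. k \<in> K \<Longrightarrow> \<omega> k \<in> forms 2"
    and v: "v \<in> forms 4" "\<And>k. k \<in> K \<Longrightarrow> \<omega> k \<^bold>\<and> \<omega> k = v" "v \<^bold>\<and> \<eta> \<noteq> 0"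
  shows "\<exists>\<xi>. \<eta> [\<xi>] = 1 \<and> (\<forall>k\<in>K. \<forall>y. \<omega> k [\<xi>, y] = 0)"
proof -
  obtain xs where xs: "(v \<^bold>\<and> \<eta>) xs \<noteq> 0" using v(3) by (auto simp: fun_eq_iff)
  have v\<eta>: "v \<^bold>\<and> \<eta> \<in> forms 5" using wedge_forms[OF v(1) \<eta>] by simp
  then have "length xs = 5" using forms_length xs by blast
  then obtain a b c d e where abcde: "xs = [a, b, c, d, e]"
    by (auto simp: length_Suc_conv numeral_eq_Suc)
  define \<xi> where "\<xi> = v [a, b, c, d] *\<^sub>R e - v [a, b, c, e] *\<^sub>R d + v [a, b, d, e] *\<^sub>R c
    - v [a, c, d, e] *\<^sub>R b + v [b, c, d, e] *\<^sub>R a"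
  have \<eta>\<xi>: "\<eta> [\<xi>] = (v \<^bold>\<and> \<eta>) xs"
    unfolding abcde \<xi>_def by (simp add: wedge_4_1[OF v(1) \<eta>] form_1_simps[OF \<eta>])
  have indep: "distinct xs" "independent (set xs)" using forms_independent[OF v\<eta> xs] by auto
  have span: "span (set xs) = UNIV"
    by (rule independent_spans) (use indep \<open>length xs = 5\<close> dim in \<open>simp_all add: distinct_card\<close>)
  have ker: "\<omega> k [\<xi>, y] = 0" if k: "k \<in> K" for k y
  proof -
    note f = \<omega>[OF k]
    have vk: "v [w, x, y, z] = 2 * (\<omega> k [w, x] * \<omega> k [y, z] - \<omega> k [w, y] * \<omega> k [x, z] + \<omega> k [w, z] * \<omega> k [x, y])"
      for w x y z
      using v(2)[OF k] wedge_2_2[OF f f, of w x y z] by simp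
    have "\<omega> k [\<xi>, y] = 0" if "y \<in> set xs" for y
    proof -
      have "\<omega> k [\<xi>, y] = v [a, b, c, d] * \<omega> k [e, y] - v [a, b, c, e] * \<omega> k [d, y] + v [a, b, d, e] * \<omega> k [c, y]
        - v [a, c, d, e] * \<omega> k [b, y] + v [b, c, d, e] * \<omega> k [a, y]"
        unfolding \<xi>_def by (simp add: form_2_simps[OF f])
      also have "\<dots> = 0"
        using that form_2_antisym[OF f, of b a] form_2_antisym[OF f, of c a] form_2_antisym[OF f, of d a]
          form_2_antisym[OF f, of e a] form_2_antisym[OF f, of c b] form_2_antisym[OF f, of d b]
          form_2_antisym[OF f, of e b] form_2_antisym[OF f, of d c] form_2_antisym[OF f, of e c]
          form_2_antisym[OF f, of e d]
        unfolding abcde vk by (auto simp: form_2_alternating[OF f] algebra_simps)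
      finally show ?thesis .
    qed
    then show ?thesis
      using linear_eq_0_on_span[OF form_2_linear_right[OF f, of \<xi>], of "set xs" y] span by auto
  qed
  have "\<eta> [\<xi>] \<noteq> 0" using \<eta>\<xi> xs by simp
  then show ?thesis
    using ker by (intro exI[of _ "(1 / \<eta> [\<xi>]) *\<^sub>R \<xi>"]) (simp add: form_1_simps[OF \<eta>] form_2_simps[OF \<omega>])
qed

text \<open>
  A combination \<open>\<sigma> = p \<omega>\<^sub>1 + q \<omega>\<^sub>2 + r \<omega>\<^sub>3\<close> has square \<open>(p\<^sup>2 + q\<^sup>2 + r\<^sup>2) v\<close>, so it cannot annihilate
  \<open>X\<close> unless it is zero. Hence the contractions of the \<open>\<omega>\<^sub>k\<close> with \<open>X\<close> and \<open>\<eta>\<close> are independent and admit dual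
  vectors, unique up to multiples of \<open>X\<close>. Three shifts by \<open>X\<close> remove three components, the relations
  \<open>\<omega>\<^sub>i \<and> \<omega>\<^sub>j = \<delta>\<^sub>i\<^sub>j v\<close> determine the others up to a common factor \<open>W\<close>, and the orientation condition on
  \<open>\<omega>\<^sub>3\<close> makes \<open>W\<close> positive, so that it can be scaled to \<open>1\<close>.
\<close>

lemma ex_adapted_basis:
  fixes \<eta> :: "'a::real_vector form"
  assumes dim: "dim (UNIV :: 'a set) = 5"
    and su2: "su2_structure \<eta> \<omega>"
  shows "\<exists>b. adapted_basis \<eta> \<omega> b"
proof -
  have \<eta>: "\<eta> \<in> forms 1" and \<omega>: "\<And>k. k \<in> {1..3} \<Longrightarrow> \<omega> k \<in> forms 2"
    using su2 by (auto simp: su2_structure_def)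
  have \<omega>123: "\<omega> 1 \<in> forms 2" "\<omega> 2 \<in> forms 2" "\<omega> 3 \<in> forms 2" by (auto intro!: \<omega>)
  obtain v where v: "v \<in> forms 4" and vij: "\<And>i j. i \<in> {1..3} \<Longrightarrow> j \<in> {1..3} \<Longrightarrow> \<omega> i \<^bold>\<and> \<omega> j = (if i = j then v else 0)"
    and v\<eta>: "v \<^bold>\<and> \<eta> \<noteq> 0"
    using su2 unfolding su2_structure_def by blast
  have pos: "\<omega> 3 [X, Y] \<ge> 0" if "interior X (\<omega> 1) = interior Y (\<omega> 2)" for X Y
    using su2 that unfolding su2_structure_def by blast
  have "\<exists>\<xi>. \<eta> [\<xi>] = 1 \<and> (\<forall>k\<in>{1..3}. \<forall>y. \<omega> k [\<xi>, y] = 0)"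
    by (rule ex_reeb_vector[OF dim \<eta> \<omega> v _ v\<eta>]) (simp_all add: vij)
  then obtain \<xi> where \<xi>: "\<eta> [\<xi>] = 1" "\<And>k y. k \<in> {1..3} \<Longrightarrow> \<omega> k [\<xi>, y] = 0"
    by blast
  have \<xi>': "\<omega> k [y, \<xi>] = 0" if "k \<in> {1..3}" for k y
    using form_2_antisym[OF \<omega>[OF that], of y \<xi>] \<xi>(2)[OF that] by simp
  have v_\<omega>: "v [w, x, y, z] = 2 * (\<omega> k [w, x] * \<omega> k [y, z] - \<omega> k [w, y] * \<omega> k [x, z] + \<omega> k [w, z] * \<omega> k [x, y])"
    if "k \<in> {1..3}" for k w x y z
    using vij[OF that that] wedge_2_2[OF \<omega>[OF that] \<omega>[OF that], of w x y z] by simp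
  have v1: "v [w, x, y, z] = 2 * (\<omega> 1 [w, x] * \<omega> 1 [y, z] - \<omega> 1 [w, y] * \<omega> 1 [x, z] + \<omega> 1 [w, z] * \<omega> 1 [x, y])"
    for w x y z
    by (rule v_\<omega>) simp

  obtain xs where xs: "v xs \<noteq> 0" using v\<eta> by (metis ext wedge_0_left zero_fun_apply)
  then have "length xs = 4" using forms_length[OF v] by blast
  then obtain x1 x2 x3 x4 where x: "xs = [x1, x2, x3, x4]"
    by (auto simp: length_Suc_conv numeral_eq_Suc)
  define X where "X = x1 - \<eta> [x1] *\<^sub>R \<xi>"
  have \<eta>X: "\<eta> [X] = 0" by (simp add: X_def form_1_simps[OF \<eta>] \<xi>)
  have vX: "v [X, x2, x3, x4] \<noteq> 0"
    using xs unfolding x v1 X_def by (simp add: form_2_simps[OF \<omega>123(1)] \<xi>)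

  define \<Phi> where "\<Phi> y = (\<omega> 1 [X, y], \<omega> 2 [X, y], \<omega> 3 [X, y], \<eta> [y])" for y
  have "linear \<Phi>"
    by (rule linearI) (simp_all add: \<Phi>_def form_1_simps[OF \<eta>] form_2_simps[OF \<omega>123(1)]
        form_2_simps[OF \<omega>123(2)] form_2_simps[OF \<omega>123(3)])
  moreover have "u = 0" if u: "\<And>y. u \<bullet> \<Phi> y = 0" for u
  proof -
    obtain p q r s where u_def: "u = (p, q, r, s)" by (cases u) auto
    have eq: "p * \<omega> 1 [X, y] + q * \<omega> 2 [X, y] + r * \<omega> 3 [X, y] + s * \<eta> [y] = 0" for y
      using u[of y] by (simp add: u_def \<Phi>_def)
    have "s = 0" using eq[of \<xi>] by (simp add: \<xi> \<xi>')
    define \<sigma> where "\<sigma> = p *\<^sub>R \<omega> 1 + q *\<^sub>R \<omega> 2 + r *\<^sub>R \<omega> 3"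
    have \<sigma>: "\<sigma> \<in> forms 2"
      unfolding \<sigma>_def by (intro subspace_add[OF subspace_forms] subspace_scale[OF subspace_forms] \<omega>123)
    have "\<sigma> [X, y] = 0" for y using eq[of y] \<open>s = 0\<close> by (simp add: \<sigma>_def)
    then have "(\<sigma> \<^bold>\<and> \<sigma>) [X, x2, x3, x4] = 0" by (simp add: wedge_2_2[OF \<sigma> \<sigma>])
    moreover have "\<sigma> \<^bold>\<and> \<sigma> = (p\<^sup>2 + q\<^sup>2 + r\<^sup>2) *\<^sub>R v"
      by (simp add: \<sigma>_def wedge_add_left wedge_add_right wedge_scaleR_left wedge_scaleR_right vij
          power2_eq_square algebra_simps)
    ultimately have "p\<^sup>2 + q\<^sup>2 + r\<^sup>2 = 0" using vX by simp
    then have "p = 0 \<and> q = 0 \<and> r = 0"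
      by (metis add.commute add_nonneg_eq_0_iff zero_le_power2 zero_eq_power2 add_nonneg_nonneg)
    with \<open>s = 0\<close> show ?thesis by (simp add: u_def zero_prod_def)
  qed
  ultimately have surj: "surj \<Phi>" by (rule linear_surjI)
  obtain y2 where "\<Phi> y2 = (1, 0, 0, 0)" by (metis surj surjD)
  then have y2: "\<omega> 1 [X, y2] = 1" "\<omega> 2 [X, y2] = 0" "\<omega> 3 [X, y2] = 0" "\<eta> [y2] = 0" by (auto simp: \<Phi>_def)
  obtain y3 where "\<Phi> y3 = (0, 1, 0, 0)" by (metis surj surjD)
  then have y3: "\<omega> 1 [X, y3] = 0" "\<omega> 2 [X, y3] = 1" "\<omega> 3 [X, y3] = 0" "\<eta> [y3] = 0" by (auto simp: \<Phi>_def)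
  obtain y4 where "\<Phi> y4 = (0, 0, 1, 0)" by (metis surj surjD)
  then have y4: "\<omega> 1 [X, y4] = 0" "\<omega> 2 [X, y4] = 0" "\<omega> 3 [X, y4] = 1" "\<eta> [y4] = 0" by (auto simp: \<Phi>_def)

  (* The shifts are the solutions of the three equations recorded in norm below. *)
  define b2 where "b2 = y2 - \<omega> 2 [y2, y3] *\<^sub>R X"
  define b3 where "b3 = y3 + \<omega> 1 [y2, y3] *\<^sub>R X"
  define b4 where "b4 = y4 + \<omega> 1 [y2, y4] *\<^sub>R X"
  note lin = form_2_simps[OF \<omega>123(1)] form_2_simps[OF \<omega>123(2)] form_2_simps[OF \<omega>123(3)] form_1_simps[OF \<eta>]
  have anti: "\<omega> 1 [y, X] = - \<omega> 1 [X, y]" "\<omega> 2 [y, X] = - \<omega> 2 [X, y]" "\<omega> 3 [y, X] = - \<omega> 3 [X, y]" for y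
    by (rule form_2_antisym \<omega>123)+
  have b2: "\<omega> 1 [X, b2] = 1" "\<omega> 2 [X, b2] = 0" "\<omega> 3 [X, b2] = 0" "\<eta> [b2] = 0"
    and b3: "\<omega> 1 [X, b3] = 0" "\<omega> 2 [X, b3] = 1" "\<omega> 3 [X, b3] = 0" "\<eta> [b3] = 0"
    and b4: "\<omega> 1 [X, b4] = 0" "\<omega> 2 [X, b4] = 0" "\<omega> 3 [X, b4] = 1" "\<eta> [b4] = 0"
    by (simp_all add: b2_def b3_def b4_def lin y2 y3 y4 \<eta>X)
  have norm: "\<omega> 1 [b2, b3] = 0" "\<omega> 1 [b2, b4] = 0" "\<omega> 2 [b2, b3] = 0"
    by (simp_all add: b2_def b3_def b4_def lin anti y2 y3 y4)
  define W where "W = \<omega> 1 [b3, b4]"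
  note w = wedge_2_2[where w = X and x = b2 and y = b3 and z = b4]
  have vW: "v [X, b2, b3, b4] = 2 * W" using v_\<omega>[of 1 X b2 b3 b4] by (simp add: b2 b3 b4 W_def)
  have W2: "\<omega> 2 [b2, b4] = - W" using v_\<omega>[of 2 X b2 b3 b4] vW by (simp add: b2 b3 b4)
  have W3: "\<omega> 3 [b2, b3] = W" using v_\<omega>[of 3 X b2 b3 b4] vW by (simp add: b2 b3 b4)
  have w12: "\<omega> 2 [b3, b4] = 0"
    using w[OF \<omega>123(1) \<omega>123(2)] vij[of 1 2] by (simp add: b2 b3 b4 norm)
  have w13: "\<omega> 3 [b3, b4] = 0"
    using w[OF \<omega>123(1) \<omega>123(3)] vij[of 1 3] by (simp add: b2 b3 b4 norm)
  have w23: "\<omega> 3 [b2, b4] = 0"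
    using w[OF \<omega>123(2) \<omega>123(3)] vij[of 2 3] by (simp add: b2 b3 b4 norm)

  note anti = anti[of b2] anti[of b3] anti[of b4]
  define c where "c = (\<lambda>_ :: nat. \<xi>)(1 := X, 2 := b2, 3 := b3, 4 := (b4 :: 'a))"
  have span: "span (c ` {1..5}) = UNIV"
  proof (rule dual_coframe_spans[OF dim \<eta> \<omega>])
    fix i j :: nat assume "i \<in> {1..5}" "j \<in> {1..5}"
    then show "dual_coframe \<eta> \<omega> c i [c j] = (if i = j then 1 else 0)"
      unfolding atLeastAtMost_1_5 c_def dual_coframe_def interior_def
      by (elim insertE emptyE) (simp_all add: b2 b3 b4 \<xi> \<xi>' norm anti \<eta>X form_2_alternating[OF \<omega>])
  qed
  have c_simps: "c 1 = X" "c 2 = b2" "c 3 = b3" "c 4 = b4" "c 5 = \<xi>" by (simp_all add: c_def)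
  have c_set: "c ` {1..5} = {X, b2, b3, b4, \<xi>}"
    unfolding atLeastAtMost_1_5 by (simp add: c_simps)
  have anti_b: "\<omega> k [b3, b2] = - \<omega> k [b2, b3]" "\<omega> k [b4, b2] = - \<omega> k [b2, b4]" "\<omega> k [b4, b3] = - \<omega> k [b3, b4]"
    if "k \<in> {1..3}" for k
    by (rule form_2_antisym \<omega> that)+

  have \<omega>_diag: "\<omega> 1 [y, y] = 0" for y by (rule form_2_alternating[OF \<omega>123(1)])
  have "W \<noteq> 0"
  proof
    assume "W = 0"
    then have W0: "\<omega> 1 [b3, b4] = 0" by (simp add: W_def)
    (* If W = 0, then omega 1 is decomposable, so its square v vanishes. *)
    define e1 e2 where "e1 = interior b2 (\<omega> 1)" and "e2 = interior X (\<omega> 1)"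
    have e: "e1 \<in> forms 1" "e2 \<in> forms 1"
      unfolding e1_def e2_def by (rule interior_form_2[OF \<omega>123(1)])+
    have "\<omega> 1 = e2 \<^bold>\<and> e1"
    proof (rule forms_2_eqI[OF \<omega>123(1) _ span])
      show "e2 \<^bold>\<and> e1 \<in> forms 2" using wedge_forms[OF e(2,1)] by simp
      fix x y assume "x \<in> c ` {1..5}" "y \<in> c ` {1..5}"
      then show "\<omega> 1 [x, y] = (e2 \<^bold>\<and> e1) [x, y]"
        unfolding c_set wedge_1_1[OF e(2,1)]
        unfolding e1_def e2_def interior_def
        by (elim insertE emptyE)
          (simp_all add: b2 b3 b4 \<xi> \<xi>' norm anti anti_b \<omega>_diag W0)
    qed
    then have dec: "\<omega> 1 [x, y] = e2 [x] * e1 [y] - e2 [y] * e1 [x]" for x y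
      by (simp only: wedge_1_1[OF e(2,1)])
    have "v [X, x2, x3, x4] = 0"
      unfolding v1 dec by (simp add: algebra_simps)
    with vX show False by simp
  qed
  moreover have "W \<ge> 0"
  proof -
    (* Contracting omega 1 with b4 gives - W e3, which is - W times the contraction of omega 2 with X. *)
    let ?Y = "- W *\<^sub>R X"
    have "interior b4 (\<omega> 1) = interior ?Y (\<omega> 2)"
    proof (rule forms_1_eqI[OF _ _ span])
      show "interior b4 (\<omega> 1) \<in> forms 1" "interior ?Y (\<omega> 2) \<in> forms 1"
        by (rule interior_form_2 \<omega>123)+
      fix x assume "x \<in> c ` {1..5}"
      then show "interior b4 (\<omega> 1) [x] = interior ?Y (\<omega> 2) [x]"
        unfolding c_set interior_def
        by (elim insertE emptyE)
          (simp_all add: b2 b3 b4 \<xi> \<xi>' norm lin anti anti_b W_def[symmetric])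
    qed
    then have "\<omega> 3 [b4, ?Y] \<ge> 0" by (rule pos)
    then show ?thesis by (simp add: lin anti b4)
  qed
  ultimately have "W > 0" by simp
  (* Scaling X by s and its dual vectors by 1 / s keeps the pairings omega k [X, _] and divides W by s * s. *)
  define s where "s = sqrt W"
  have s: "s \<noteq> 0" "W = s * s" using \<open>W > 0\<close> by (auto simp: s_def)
  have W1: "\<omega> 1 [b3, b4] = W" by (simp add: W_def)
  note entries = W1[unfolded s] W2[unfolded s] W3[unfolded s] w12 w13 w23 norm

  define b where "b = (\<lambda>_ :: nat. \<xi>)(1 := s *\<^sub>R X, 2 := (1 / s) *\<^sub>R b2, 3 := (1 / s) *\<^sub>R b3, 4 := (1 / s) *\<^sub>R (b4 :: 'a))"
  have "adapted_basis \<eta> \<omega> b"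
  proof (rule adapted_basisI[OF dim \<eta> \<omega>])
    fix i :: nat assume "i \<in> {1..5}"
    then show "\<eta> [b i] = (if i = 5 then 1 else 0)"
      unfolding atLeastAtMost_1_5 by (elim insertE emptyE) (simp_all add: b_def \<xi> b2 b3 b4 lin \<eta>X)
  next
    fix k i j :: nat assume "k \<in> {1..3}" "i \<in> {1..5}" "j \<in> {1..5}" "i < j"
    then show "\<omega> k [b i, b j] = std_omega k i j"
      unfolding atLeastAtMost_1_5 atLeastAtMost_1_3
      by (elim insertE emptyE)
        (simp_all add: b_def \<xi>' b2 b3 b4 lin entries \<open>s \<noteq> 0\<close> std_omega_eval)
  qed
  then show ?thesis by blast
qed

text \<open>
  The first vector of the new basis is the unit vector \<open>u\<close> along the gradient of \<open>\<alpha>\<close>; the next three are its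
  images under the complex structures \<open>J\<^sub>1, J\<^sub>2, J\<^sub>3\<close> given by \<open>\<omega>\<^sub>1, \<omega>\<^sub>2, \<omega>\<^sub>3\<close>, which are orthogonal to
  \<open>u\<close>. The normal form is preserved because it expresses exactly that \<open>b\<^sub>2, b\<^sub>3, b\<^sub>4\<close> are such images of
  a unit vector \<open>b\<^sub>1\<close>.
\<close>

lemma adapted_basis_rotate:
  fixes b :: "nat \<Rightarrow> 'a::real_vector" and \<alpha> :: "'a \<Rightarrow> real"
  assumes dim: "dim (UNIV :: 'a set) = 5"
    and \<eta>: "\<eta> \<in> forms 1" and \<omega>: "\<And>k. k \<in> {1..3} \<Longrightarrow> \<omega> k \<in> forms 2"
    and b: "adapted_basis \<eta> \<omega> b"
    and \<alpha>: "linear \<alpha>" "\<alpha> (b 5) = 0" "\<alpha> x \<noteq> 0"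
  shows "\<exists>b'. adapted_basis \<eta> \<omega> b' \<and> \<alpha> (b' 1) \<noteq> 0 \<and> (\<forall>i\<in>{2..5}. \<alpha> (b' i) = 0)"
proof -
  define r where "r = sqrt ((\<alpha> (b 1))\<^sup>2 + (\<alpha> (b 2))\<^sup>2 + (\<alpha> (b 3))\<^sup>2 + (\<alpha> (b 4))\<^sup>2)"
  define p q s t where "p = \<alpha> (b 1) / r" and "q = \<alpha> (b 2) / r" and "s = \<alpha> (b 3) / r" and "t = \<alpha> (b 4) / r"
  have "span (b ` {1..5}) = UNIV" using b by (simp add: adapted_basis_def)
  then have "\<not> (\<forall>i\<in>{1..5}. \<alpha> (b i) = 0)"
    using linear_eq_0_on_span[OF \<alpha>(1), of "b ` {1..5}" x] \<alpha>(3) by auto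
  then have "0 < (\<alpha> (b 1))\<^sup>2 + (\<alpha> (b 2))\<^sup>2 + (\<alpha> (b 3))\<^sup>2 + (\<alpha> (b 4))\<^sup>2"
    unfolding atLeastAtMost_1_5 using \<alpha>(2)
    by (auto simp: add_pos_nonneg add_nonneg_pos)
  then have r: "r > 0" "r\<^sup>2 = (\<alpha> (b 1))\<^sup>2 + (\<alpha> (b 2))\<^sup>2 + (\<alpha> (b 3))\<^sup>2 + (\<alpha> (b 4))\<^sup>2"
    by (simp_all add: r_def)
  have "p * p + (q * q + (s * s + t * t))
      = ((\<alpha> (b 1))\<^sup>2 + (\<alpha> (b 2))\<^sup>2 + (\<alpha> (b 3))\<^sup>2 + (\<alpha> (b 4))\<^sup>2) / r\<^sup>2"
    by (simp add: p_def q_def s_def t_def power2_eq_square add_divide_distrib)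
  then have unit: "p * p + (q * q + (s * s + t * t)) = 1"
    using r(1) unfolding r(2)[symmetric] by simp
  have \<alpha>_b: "\<alpha> (b 1) = r * p" "\<alpha> (b 2) = r * q" "\<alpha> (b 3) = r * s" "\<alpha> (b 4) = r * t"
    using r by (simp_all add: p_def q_def s_def t_def)
  define b' where "b' = (\<lambda>_ :: nat. b 5)(
     1 := p *\<^sub>R b 1 + q *\<^sub>R b 2 + s *\<^sub>R b 3 + t *\<^sub>R b 4,
     2 := p *\<^sub>R b 2 - q *\<^sub>R b 1 + s *\<^sub>R b 4 - t *\<^sub>R b 3,
     3 := p *\<^sub>R b 3 - q *\<^sub>R b 4 - s *\<^sub>R b 1 + t *\<^sub>R b 2,
     4 := p *\<^sub>R b 4 + q *\<^sub>R b 3 - s *\<^sub>R b 2 - t *\<^sub>R b 1)"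
  have \<eta>_b: "\<eta> [b i] = (if i = 5 then 1 else 0)" if "i \<in> {1..5}" for i
    using b that by (simp add: adapted_basis_def)
  have \<omega>_b: "\<omega> k [b i, b j] = std_omega k i j" if "k \<in> {1..3}" "i \<in> {1..5}" "j \<in> {1..5}" for k i j
    using b that by (simp add: adapted_basis_def)
  have "adapted_basis \<eta> \<omega> b'"
  proof (rule adapted_basisI[OF dim \<eta> \<omega>])
    fix i :: nat assume "i \<in> {1..5}"
    then show "\<eta> [b' i] = (if i = 5 then 1 else 0)"
      unfolding atLeastAtMost_1_5
      by (elim insertE emptyE) (simp_all add: b'_def form_1_simps[OF \<eta>] \<eta>_b)
  next
    fix k i j :: nat assume k: "k \<in> {1..3}" and ij: "i \<in> {1..5}" "j \<in> {1..5}" "i < j"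
    note lin = form_2_simps[OF \<omega>[OF k]]
    show "\<omega> k [b' i, b' j] = std_omega k i j"
      using ij unfolding atLeastAtMost_1_5
      by (elim insertE emptyE)
        (use k unit in \<open>auto simp: atLeastAtMost_1_3 b'_def lin \<omega>_b std_omega_eval algebra_simps\<close>)
  qed
  moreover have "\<alpha> (b' 1) = r"
  proof -
    have "\<alpha> (b' 1) = r * (p * p + (q * q + (s * s + t * t)))"
      by (simp add: b'_def linear_add[OF \<alpha>(1)] linear_scale[OF \<alpha>(1)] \<alpha>_b algebra_simps)
    then show ?thesis by (simp add: unit)
  qed
  moreover have "\<alpha> (b' i) = 0" if "i \<in> {2..5}" for i
  proof -
    have "i \<in> {2, 3, 4, 5}" using that by auto
    then show ?thesis
      by (elim insertE emptyE) (simp_all add: b'_def linear_add[OF \<alpha>(1)] linear_diff[OF \<alpha>(1)]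
          linear_scale[OF \<alpha>(1)] \<alpha>_b \<alpha>(2) algebra_simps)
  qed
  ultimately show ?thesis using r(1) by auto
qed

section \<open>Structure constants of double hypo Lie algebras\<close>

text \<open>The components of \<open>\<eta> \<and> \<omega>\<^sub>k\<close> in an adapted basis.\<close>

definition eta_omega :: "nat \<Rightarrow> nat \<Rightarrow> nat \<Rightarrow> nat \<Rightarrow> real" where
  "eta_omega k i j l =
     of_bool (i = 5) * std_omega k j l - of_bool (j = 5) * std_omega k i l + of_bool (l = 5) * std_omega k i j"

text \<open>
  If \<open>a k i j\<close> are the components of \<open>de\<^sup>k\<close>, then the following are the components of \<open>d\<sigma>\<close> for the 2-form with
  components \<open>s\<close>, and those of \<open>d\<tau>\<close> for the 3-form with components \<open>t\<close>. The bracket is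
  \<open>[b\<^sub>i, b\<^sub>j] = - \<Sum>\<^sub>m a m i j b\<^sub>m\<close>, which absorbs the sign of the differential.
\<close>

definition d2_coeff :: "(nat \<Rightarrow> nat \<Rightarrow> nat \<Rightarrow> real) \<Rightarrow> (nat \<Rightarrow> nat \<Rightarrow> real) \<Rightarrow> nat \<Rightarrow> nat \<Rightarrow> nat \<Rightarrow> real" where
  "d2_coeff a s i j l = (\<Sum>m = 1..5. a m i j * s m l - a m i l * s m j + a m j l * s m i)"

definition d3_coeff :: "(nat \<Rightarrow> nat \<Rightarrow> nat \<Rightarrow> real) \<Rightarrow> (nat \<Rightarrow> nat \<Rightarrow> nat \<Rightarrow> real) \<Rightarrow>
    nat \<Rightarrow> nat \<Rightarrow> nat \<Rightarrow> nat \<Rightarrow> real" where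
  "d3_coeff a t i j l n = (\<Sum>m = 1..5. a m i j * t m l n - a m i l * t m j n + a m i n * t m j l
     + a m j l * t m i n - a m j n * t m i l + a m l n * t m i j)"

text \<open>
  The components of \<open>de\<^sup>1, \<dots>, de\<^sup>5\<close> for a double hypo structure. The factor \<open>- 4\<close> in the last equation arises
  because a component of \<open>\<omega>\<^sub>1 \<and> \<omega>\<^sub>1\<close> is twice the corresponding Pfaffian.
\<close>

locale double_hypo_coefficients =
  fixes a :: "nat \<Rightarrow> nat \<Rightarrow> nat \<Rightarrow> real"
  assumes antisym: "a k j i = - a k i j"
    and jacobi: "k \<in> {1..5} \<Longrightarrow> i \<in> {1..5} \<Longrightarrow> j \<in> {1..5} \<Longrightarrow> l \<in> {1..5} \<Longrightarrow>
      (\<Sum>m = 1..5. a m i j * a k m l - a m i l * a k m j + a m j l * a k m i) = 0"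
    and d_omega1: "i \<in> {1..5} \<Longrightarrow> j \<in> {1..5} \<Longrightarrow> l \<in> {1..5} \<Longrightarrow>
      d2_coeff a (std_omega 1) i j l = 3 * eta_omega 2 i j l"
    and d_omega3: "i \<in> {1..5} \<Longrightarrow> j \<in> {1..5} \<Longrightarrow> l \<in> {1..5} \<Longrightarrow>
      d2_coeff a (std_omega 3) i j l = 0"
    and d_eta_omega1: "i \<in> {1..5} \<Longrightarrow> j \<in> {1..5} \<Longrightarrow> l \<in> {1..5} \<Longrightarrow> n \<in> {1..5} \<Longrightarrow>
      d3_coeff a (eta_omega 1) i j l n = 0"
    and d_eta_omega2: "i \<in> {1..5} \<Longrightarrow> j \<in> {1..5} \<Longrightarrow> l \<in> {1..5} \<Longrightarrow> n \<in> {1..5} \<Longrightarrow>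
      d3_coeff a (eta_omega 2) i j l n = 0"
    and d_eta_omega3: "i \<in> {1..5} \<Longrightarrow> j \<in> {1..5} \<Longrightarrow> l \<in> {1..5} \<Longrightarrow> n \<in> {1..5} \<Longrightarrow>
      d3_coeff a (eta_omega 3) i j l n
        = - 4 * (std_omega 1 i j * std_omega 1 l n - std_omega 1 i l * std_omega 1 j n + std_omega 1 i n * std_omega 1 j l)"
begin

lemma diag: "a k i i = 0"
  using antisym[of k i i] by simp

lemma antisym_numerals:
  "a k 2 1 = - a k 1 2" "a k 3 1 = - a k 1 3" "a k 4 1 = - a k 1 4" "a k 5 1 = - a k 1 5" "a k 3 2 = - a k 2 3"
  "a k 4 2 = - a k 2 4" "a k 5 2 = - a k 2 5" "a k 4 3 = - a k 3 4" "a k 5 3 = - a k 3 5" "a k 5 4 = - a k 4 5"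
  by (rule antisym)+

lemmas coefficient_eval = d2_coeff_def d3_coeff_def eta_omega_def std_omega_eval atLeastAtMost_1_5 diag antisym_numerals

lemmas d_omega3_eqs =
  d_omega3[of 1 2 3] d_omega3[of 1 2 4] d_omega3[of 1 2 5] d_omega3[of 1 3 4] d_omega3[of 1 3 5]
  d_omega3[of 1 4 5] d_omega3[of 2 3 4] d_omega3[of 2 3 5] d_omega3[of 2 4 5] d_omega3[of 3 4 5]
lemmas d_eta_omega3_eqs =
  d_eta_omega3[of 1 2 3 4] d_eta_omega3[of 1 2 3 5] d_eta_omega3[of 1 2 4 5] d_eta_omega3[of 1 3 4 5] d_eta_omega3[of 2 3 4 5]
lemmas d_omega1_eqs =
  d_omega1[of 1 2 3] d_omega1[of 1 2 4] d_omega1[of 1 2 5] d_omega1[of 1 3 4] d_omega1[of 1 3 5]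
  d_omega1[of 1 4 5] d_omega1[of 2 3 4] d_omega1[of 2 3 5] d_omega1[of 2 4 5] d_omega1[of 3 4 5]
lemmas d_eta_omega1_eqs =
  d_eta_omega1[of 1 2 3 4] d_eta_omega1[of 1 2 3 5] d_eta_omega1[of 1 2 4 5] d_eta_omega1[of 1 3 4 5] d_eta_omega1[of 2 3 4 5]
lemmas d_eta_omega2_eqs =
  d_eta_omega2[of 1 2 3 4] d_eta_omega2[of 1 2 3 5] d_eta_omega2[of 1 2 4 5] d_eta_omega2[of 1 3 4 5] d_eta_omega2[of 2 3 4 5]

lemmas w3_linear = d_omega3_eqs[simplified coefficient_eval, simplified]
lemmas ew3_linear = d_eta_omega3_eqs[simplified coefficient_eval, simplified]
lemmas w1_linear = d_omega1_eqs[simplified coefficient_eval, simplified]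
lemmas ew1_linear = d_eta_omega1_eqs[simplified coefficient_eval, simplified]
lemmas ew2_linear = d_eta_omega2_eqs[simplified coefficient_eval, simplified]

text \<open>
  This is \<open>\<omega>\<^sub>3 \<and> d\<omega>\<^sub>3 = 0\<close>: the form \<open>\<omega>\<^sub>3 \<and> \<omega>\<^sub>3\<close> is twice \<open>i\<^sub>b\<^sub>5 vol\<close> up to sign, and its differential
  measures \<open>tr (ad b\<^sub>5)\<close>.
\<close>

lemma trace_5: "(\<Sum>k = 1..5. a k 5 k) = 0"
  using w3_linear unfolding atLeastAtMost_1_5 by (simp add: diag antisym_numerals)

text \<open>
  The coordinate form of \<open>d(\<alpha> \<and> \<eta> \<and> \<omega>\<^sub>3) = 2 \<alpha> \<and> \<omega>\<^sub>1 \<and> \<omega>\<^sub>1\<close> on a unimodular algebra. There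
  \<open>de\<^sup>m \<and> \<omega>\<^sub>3\<close> has no \<open>e\<^sup>1\<^sup>2\<^sup>3\<^sup>4\<close> component for \<open>m \<le> 4\<close>, whereas that of \<open>d\<eta> \<and> \<omega>\<^sub>3\<close> is \<open>-4\<close>; so \<open>d\<alpha> \<and> \<omega>\<^sub>3 = 0\<close>
  leaves only \<open>-4 \<alpha>\<^sub>5 = 0\<close>.
\<close>

lemma closed_form_horizontal_if_unimodular:
  assumes trace: "\<And>i. i \<in> {1..5} \<Longrightarrow> (\<Sum>k = 1..5. a k i k) = 0"
    and closed: "\<And>i j. i \<in> {1..5} \<Longrightarrow> j \<in> {1..5} \<Longrightarrow> (\<Sum>k = 1..5. \<alpha> k * a k i j) = 0"
  shows "\<alpha> 5 = 0"
proof -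
  have tr: "a 2 1 2 + a 3 1 3 + a 4 1 4 + a 5 1 5 = 0" "- a 1 1 2 + a 3 2 3 + a 4 2 4 + a 5 2 5 = 0"
    "- a 1 1 3 - a 2 2 3 + a 4 3 4 + a 5 3 5 = 0" "- a 1 1 4 - a 2 2 4 - a 3 3 4 + a 5 4 5 = 0"
    using trace[of 1] trace[of 2] trace[of 3] trace[of 4] by (simp_all add: atLeastAtMost_1_5 diag antisym_numerals)
  have "a 1 1 4 + a 1 2 3 = 0" "a 2 1 4 + a 2 2 3 = 0" "a 3 1 4 + a 3 2 3 = 0" "a 4 1 4 + a 4 2 3 = 0"
    using tr w3_linear ew3_linear by linarith+
  moreover have "a 5 1 4 + a 5 2 3 = - 4"
    using ew3_linear by linarith
  moreover have "\<alpha> 1 * a 1 1 4 + \<alpha> 2 * a 2 1 4 + \<alpha> 3 * a 3 1 4 + \<alpha> 4 * a 4 1 4 + \<alpha> 5 * a 5 1 4 = 0"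
    "\<alpha> 1 * a 1 2 3 + \<alpha> 2 * a 2 2 3 + \<alpha> 3 * a 3 2 3 + \<alpha> 4 * a 4 2 3 + \<alpha> 5 * a 5 2 3 = 0"
    using closed[of 1 4] closed[of 2 3] by (simp_all add: atLeastAtMost_1_5)
  ultimately show ?thesis by algebra
qed

text \<open>
  The linear equations express all components through \<open>\<mu>\<close> and the ten others named in the proof. The
  facts \<open>Jk_ijl\<close> are the Jacobi identities \<open>d(de\<^sup>k)(b\<^sub>i, b\<^sub>j, b\<^sub>l) = 0\<close> in these unknowns.
\<close>

lemma coefficients_if_closed:
  assumes closed: "\<And>i j. a 1 i j = 0"
  defines "\<mu> \<equiv> a 4 1 4"
  shows "a 2 1 2 = 0" "a 2 1 3 = 0" "a 2 1 4 = 0" "a 2 1 5 = 0" "a 2 2 3 = 0" "a 2 2 4 = 0" "a 2 2 5 = 0"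
    "a 2 3 4 = \<mu>" "a 2 3 5 = - 3" "a 2 4 5 = 0"
    "a 3 1 2 = 0" "a 3 1 3 = 0" "a 3 1 4 = 0" "a 3 1 5 = 0" "a 3 2 3 = 0" "a 3 2 4 = - \<mu>" "a 3 2 5 = 3"
    "a 3 3 4 = 0" "a 3 3 5 = 0" "a 3 4 5 = 0"
    "a 4 1 2 = 0" "a 4 1 3 = 0" "a 4 1 5 = 0" "a 4 2 3 = 0" "a 4 2 4 = 0" "a 4 2 5 = 0"
    "a 4 3 4 = 0" "a 4 3 5 = 0" "a 4 4 5 = 0"
    "a 5 1 2 = 0" "a 5 1 3 = 0" "a 5 1 4 = \<mu>\<^sup>2 / 3" "a 5 1 5 = 0" "a 5 2 3 = - 4 - \<mu>\<^sup>2 / 3" "a 5 2 4 = 0"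
    "a 5 2 5 = 0" "a 5 3 4 = 0" "a 5 3 5 = 0" "a 5 4 5 = 0"
proof -
  define b f g p q r where "b = a 3 2 4" and "f = a 4 2 3" and "g = a 5 2 3" and "p = a 4 3 4" and "q = a 4 3 5"
    and "r = a 4 1 5"
  define s t u where "s = a 3 3 4" and "t = a 4 2 4" and "u = a 5 2 4"
  define w where "w = a 5 3 4"
  note linear = w3_linear[unfolded closed] ew3_linear[unfolded closed] w1_linear[unfolded closed]
    ew1_linear[unfolded closed] ew2_linear[unfolded closed]
  have lin2: "a 2 1 2 = - b - \<mu>" "a 2 1 3 = - s" "a 2 1 4 = - p" "a 2 1 5 = - q" "a 2 2 3 = p" "a 2 2 4 = - s"
    "a 2 2 5 = 0" "a 2 3 4 = b + 2 * \<mu> + f" "a 2 3 5 = - 3 + r" "a 2 4 5 = 0"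
    using linear unfolding b_def f_def p_def q_def r_def s_def t_def \<mu>_def by linarith+
  have lin3: "a 3 1 2 = - s" "a 3 1 3 = b + \<mu> + f" "a 3 1 4 = t" "a 3 1 5 = 0" "a 3 2 3 = - t" "a 3 2 5 = 3"
    "a 3 3 5 = 0" "a 3 4 5 = 0"
    using linear unfolding b_def f_def p_def q_def r_def s_def t_def \<mu>_def by linarith+
  have lin4: "a 4 1 2 = - p" "a 4 1 3 = t" "a 4 2 5 = 0" "a 4 4 5 = 0"
    using linear unfolding b_def f_def p_def q_def r_def s_def t_def \<mu>_def by linarith+
  have lin5: "a 5 1 2 = - w" "a 5 1 3 = u" "a 5 1 4 = - 4 - g" "a 5 1 5 = 0" "a 5 2 5 = 0" "a 5 3 5 = 0" "a 5 4 5 = 0"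
    using linear unfolding g_def u_def w_def by linarith+
  note def_folds = b_def[symmetric] f_def[symmetric] g_def[symmetric] p_def[symmetric] q_def[symmetric] r_def[symmetric]
    s_def[symmetric] t_def[symmetric] u_def[symmetric] w_def[symmetric] \<mu>_def[symmetric]
  note jac = coefficient_eval lin2 lin3 lin4 lin5 def_folds closed
  have "w = 0" using jacobi[of 3 2 3 4] by (simp add: jac)
  have "s = 0" using jacobi[of 3 2 4 5] by (simp add: jac)
  have J2_135: "- 6 * b + 3 * b * r - 6 * \<mu> + 4 * \<mu> * r + 2 * r * f - 3 * f + 2 * p * q = 0"
    using jacobi[of 2 1 3 5] by (simp add: jac algebra_simps)
  have J2_134: "12 + 2 * b * b + 7 * b * \<mu> + 3 * b * f + 6 * \<mu> * \<mu> + 5 * \<mu> * f - 4 * r - r * g + f * f + 2 * p * p + 3 * g = 0"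
    using jacobi[of 2 1 3 4] by (simp add: jac \<open>w = 0\<close> \<open>s = 0\<close> algebra_simps)
  have J3_125: "- 6 * b + b * r - 6 * \<mu> - 3 * f = 0"
    using jacobi[of 3 1 2 5] by (simp add: jac algebra_simps)
  have J2_145: "(r - 3) * t = 0"
    using jacobi[of 2 1 4 5] by (simp add: jac \<open>s = 0\<close> algebra_simps)
  have J2_234: "(r - 3) * u = 0"
    using jacobi[of 2 2 3 4] by (simp add: jac \<open>s = 0\<close> algebra_simps)
  have J3_124: "12 + 2 * b * b + b * \<mu> + b * f + 2 * t * t + 3 * g = 0"
    using jacobi[of 3 1 2 4] by (simp add: jac \<open>s = 0\<close> algebra_simps)
  have J4_123: "- \<mu> * f - r * g + f * f + 2 * t * t + 2 * p * p = 0"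
    using jacobi[of 4 1 2 3] by (simp add: jac \<open>w = 0\<close> \<open>s = 0\<close> algebra_simps)
  have J4_245: "b * q = 3 * p"
    using jacobi[of 4 2 4 5] by (simp add: jac \<open>s = 0\<close> algebra_simps)
  have J4_135: "b * q + 2 * r * p + 2 * f * q - 3 * p = 0"
    using jacobi[of 4 1 3 5] by (simp add: jac \<open>s = 0\<close> algebra_simps)
  have J4_134: "2 * b * p + 3 * \<mu> * p + 3 * f * p - 4 * q - q * g = 0"
    using jacobi[of 4 1 3 4] by (simp add: jac \<open>w = 0\<close> \<open>s = 0\<close> algebra_simps)
  (* For r = 3 the identity J3_125 determines f, and J3_124 and J4_123 together exhibit a sum of
     squares equal to - 12. *)
  have "r \<noteq> 3"
  proof
    assume r: "r = 3"
    then have f: "f = - b - 2 * \<mu>" using J3_125 by simp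
    have "2 * (b + \<mu>)\<^sup>2 + 4 * \<mu>\<^sup>2 + 4 * t\<^sup>2 + 2 * p\<^sup>2 + 12 = 0"
      using J3_124 J4_123 unfolding r f by algebra
    moreover have "2 * (b + \<mu>)\<^sup>2 + 4 * \<mu>\<^sup>2 + 4 * t\<^sup>2 + 2 * p\<^sup>2 \<ge> 0" by simp
    ultimately show False by linarith
  qed
  then have "t = 0" "u = 0" using J2_145 J2_234 by auto
  note zero = \<open>w = 0\<close> \<open>s = 0\<close> \<open>t = 0\<close> \<open>u = 0\<close>
  have J5_123: "f * (g + 2) = 0"
    using jacobi[of 5 1 2 3] by (simp add: jac zero algebra_simps)
  have J5_134: "p * (g + 2) = 0"
    using jacobi[of 5 1 3 4] by (simp add: jac zero algebra_simps)
  have J5_135: "q * (g + 2) = 0"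
    using jacobi[of 5 1 3 5] by (simp add: jac zero algebra_simps)
  have rp: "r * p + f * q = 0" using J4_135 J4_245 by algebra
  have rb: "r * (b + 2 * \<mu> + f) + p * q = 0" using J2_135 J3_125 by algebra
  (* The identities of d (de5) = 0 carry the factor g + 2. If it vanished, J3_124 would give B; each of
     the ways to satisfy the other identities then makes a sum of squares negative. *)
  have "g \<noteq> - 2"
  proof
    assume g: "g = - 2"
    have B: "b * (2 * b + \<mu> + f) = - 6" using J3_124 unfolding g zero by algebra
    then have "b \<noteq> 0" by auto
    have A: "6 * b * \<mu> + 2 * b * f + 6 * \<mu>\<^sup>2 + 4 * \<mu> * f + 2 * f\<^sup>2 + 4 * p\<^sup>2 = 0"
      using J2_134 J3_124 J4_123 unfolding g zero by algebra
    have "p = 0"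
    proof (rule ccontr)
      assume "p \<noteq> 0"
      moreover have "p * (r * b + 3 * f) = 0" using rp J4_245 by algebra
      ultimately have "r * b = - 3 * f" by auto
      then have "\<mu> + f = - b" using J3_125 by algebra
      then have "b\<^sup>2 = - 6" using B by algebra
      then show False using zero_le_power2[of b] by linarith
    qed
    then have A0: "6 * b * \<mu> + 2 * b * f + 6 * \<mu>\<^sup>2 + 4 * \<mu> * f + 2 * f\<^sup>2 = 0" using A by simp
    have "r * (b + 2 * \<mu> + f) = 0" using rb \<open>p = 0\<close> by simp
    then have "r = 0 \<or> f = - b - 2 * \<mu>" unfolding mult_eq_0_iff by linarith
    then consider "r = 0" | "f = - b - 2 * \<mu>" by blast
    then show False
    proof cases
      case 1
      then have f: "f = - 2 * b - 2 * \<mu>" using J3_125 by simp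
      have "b * \<mu> = 6" using B unfolding f by algebra
      moreover have "4 * b\<^sup>2 + 10 * (b * \<mu>) + 6 * \<mu>\<^sup>2 = 0" using A0 unfolding f by algebra
      ultimately show False using zero_le_power2[of b] zero_le_power2[of \<mu>] by linarith
    next
      case 2
      have "b\<^sup>2 + \<mu>\<^sup>2 + 6 = 0" using A0 B unfolding 2 by algebra
      then show False using zero_le_power2[of b] zero_le_power2[of \<mu>] by linarith
    qed
  qed
  then have zero2: "f = 0" "p = 0" "q = 0" using J5_123 J5_134 J5_135 by (auto simp: add_eq_0_iff)
  have "r = 0"
  proof (rule ccontr)
    assume "r \<noteq> 0"
    then have "g = 0" "b = - 2 * \<mu>" using J4_123 rb unfolding zero zero2 by (auto simp: add_eq_0_iff)
    then have "6 * \<mu>\<^sup>2 + 12 = 0" using J3_124 unfolding zero zero2 by algebra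
    then show False using zero_le_power2[of \<mu>] by linarith
  qed
  then have b: "b = - \<mu>" using J3_125 zero2 by simp
  have g: "g = - 4 - \<mu>\<^sup>2 / 3" using J3_124 unfolding zero zero2 b by (simp add: power2_eq_square)
  have named: "a 3 2 4 = b" "a 4 2 3 = f" "a 5 2 3 = g" "a 4 3 4 = p" "a 4 3 5 = q" "a 4 1 5 = r"
    "a 3 3 4 = s" "a 4 2 4 = t" "a 5 2 4 = u" "a 5 3 4 = w"
    by (simp_all add: def_folds)
  note solved = lin2 lin3 lin4 lin5 named zero zero2 \<open>r = 0\<close> b g
  show "a 2 1 2 = 0" "a 2 1 3 = 0" "a 2 1 4 = 0" "a 2 1 5 = 0" "a 2 2 3 = 0" "a 2 2 4 = 0" "a 2 2 5 = 0"
    "a 2 3 4 = \<mu>" "a 2 3 5 = - 3" "a 2 4 5 = 0"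
    "a 3 1 2 = 0" "a 3 1 3 = 0" "a 3 1 4 = 0" "a 3 1 5 = 0" "a 3 2 3 = 0" "a 3 2 4 = - \<mu>" "a 3 2 5 = 3"
    "a 3 3 4 = 0" "a 3 3 5 = 0" "a 3 4 5 = 0"
    "a 4 1 2 = 0" "a 4 1 3 = 0" "a 4 1 5 = 0" "a 4 2 3 = 0" "a 4 2 4 = 0" "a 4 2 5 = 0"
    "a 4 3 4 = 0" "a 4 3 5 = 0" "a 4 4 5 = 0"
    "a 5 1 2 = 0" "a 5 1 3 = 0" "a 5 1 4 = \<mu>\<^sup>2 / 3" "a 5 1 5 = 0" "a 5 2 3 = - 4 - \<mu>\<^sup>2 / 3" "a 5 2 4 = 0"
    "a 5 2 5 = 0" "a 5 3 4 = 0" "a 5 3 5 = 0" "a 5 4 5 = 0"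
    by (simp_all add: solved)
qed

end

section \<open>The Lie algebra in an adapted basis\<close>

locale adapted_lie_algebra =
  fixes br :: "'a::real_vector \<Rightarrow> 'a \<Rightarrow> 'a" and \<eta> :: "'a form" and \<omega> :: "nat \<Rightarrow> 'a form" and b :: "nat \<Rightarrow> 'a"
  assumes lie: "lie_algebra br"
    and hypo: "double_hypo br \<eta> \<omega>"
    and adapted: "adapted_basis \<eta> \<omega> b"
begin

lemma \<eta>_form: "\<eta> \<in> forms 1" and \<omega>_form: "k \<in> {1..3} \<Longrightarrow> \<omega> k \<in> forms 2"
  using hypo by (auto simp: double_hypo_def hypo_def su2_structure_def)

lemma span_b: "span (b ` {1..5}) = UNIV"
  and \<eta>_b: "i \<in> {1..5} \<Longrightarrow> \<eta> [b i] = of_bool (i = 5)"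
  and \<omega>_b: "k \<in> {1..3} \<Longrightarrow> i \<in> {1..5} \<Longrightarrow> j \<in> {1..5} \<Longrightarrow> \<omega> k [b i, b j] = std_omega k i j"
  using adapted by (auto simp: adapted_basis_def)

lemma bilinear_br: "bilinear br" and br_self: "br x x = 0"
  and br_jacobi: "br x (br y z) + br y (br z x) + br z (br x y) = 0"
  using lie by (auto simp: lie_algebra_def)

lemma br_antisym: "br y x = - br x y"
proof -
  have "0 = br (x + y) (x + y)" by (simp only: br_self)
  also have "\<dots> = br x y + br y x"
    unfolding bilinear_ladd[OF bilinear_br] bilinear_radd[OF bilinear_br] by (simp add: br_self)
  finally have "br x y + br y x = 0" by (rule sym)
  then show ?thesis by (simp add: add_eq_0_iff)
qed

abbreviation e :: "nat \<Rightarrow> 'a form" where "e \<equiv> dual_coframe \<eta> \<omega> b"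

lemma e_form: "e k \<in> forms 1"
  using dual_coframe_forms \<eta>_form \<omega>_form by blast

lemmas e_linear = form_1_linear[OF e_form]

lemma e_b:
  assumes "i \<in> {1..5}" "j \<in> {1..5}"
  shows "e i [b j] = of_bool (i = j)"
  using assms unfolding atLeastAtMost_1_5
  by (elim insertE emptyE) (simp_all add: dual_coframe_def interior_def \<omega>_b \<eta>_b std_omega_eval)

lemma basis_expansion: "x = (\<Sum>k = 1..5. e k [x] *\<^sub>R b k)"
proof (rule linear_eq_on_span[of "\<lambda>x. x" "\<lambda>x. \<Sum>k = 1..5. e k [x] *\<^sub>R b k" "b ` {1..5}"])
  show "linear (\<lambda>x. \<Sum>k = 1..5. e k [x] *\<^sub>R b k)"
    by (rule linearI) (simp_all add: linear_add[OF e_linear] linear_scale[OF e_linear] scaleR_add_left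
        sum.distrib scaleR_sum_right)
  fix x assume "x \<in> b ` {1..5}"
  then obtain j where "j \<in> {1..5}" "x = b j" by blast
  then show "x = (\<Sum>k = 1..5. e k [x] *\<^sub>R b k)"
    by (simp add: e_b of_bool_def if_distrib[of "\<lambda>c. c *\<^sub>R _"] sum.delta cong: if_cong)
qed (auto simp: span_b intro: linear_id[unfolded id_def])

lemma coframe_e: "coframe e 5"
proof -
  have "inj_on e {1..5} \<and> independent (e ` {1..5})"
  proof (rule dual_functionals_independent[where f = "\<lambda>i \<phi>. \<phi> [b i]"])
    show "linear (\<lambda>\<phi>. \<phi> [b i])" for i
      by (rule linearI) simp_all
  qed (simp_all add: e_b)
  moreover have "span (e ` {1..5}) = forms 1"
  proof
    show "span (e ` {1..5}) \<subseteq> forms 1"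
      by (rule span_minimal[OF _ subspace_forms]) (use e_form in auto)
    show "forms 1 \<subseteq> span (e ` {1..5})"
    proof
      fix \<phi> :: "'a form" assume \<phi>: "\<phi> \<in> forms 1"
      let ?\<psi> = "\<Sum>k = 1..5. \<phi> [b k] *\<^sub>R e k"
      have "\<phi> = ?\<psi>"
      proof (rule forms_1_eqI[OF \<phi> _ span_b])
        show "?\<psi> \<in> forms 1"
          by (intro subspace_sum[OF subspace_forms] subspace_scale[OF subspace_forms] e_form)
        fix x assume "x \<in> b ` {1..5}"
        then show "\<phi> [x] = ?\<psi> [x]"
          unfolding atLeastAtMost_1_5 by (auto simp: e_b)
      qed
      also have "\<dots> \<in> span (e ` {1..5})"
        by (intro span_sum span_scale span_base) auto
      finally show "\<phi> \<in> span (e ` {1..5})" .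
    qed
  qed
  ultimately show ?thesis by (simp add: coframe_def)
qed

definition a :: "nat \<Rightarrow> nat \<Rightarrow> nat \<Rightarrow> real" where
  "a k i j = ce_diff br (e k) [b i, b j]"

lemma br_b: "br (b i) (b j) = (\<Sum>k = 1..5. (- a k i j) *\<^sub>R b k)"
  using basis_expansion[of "br (b i) (b j)"] by (simp add: a_def ce_diff_2)

lemma form_2_br: "\<alpha> \<in> forms 2 \<Longrightarrow> \<alpha> [br (b i) (b j), x] = - (\<Sum>m = 1..5. a m i j * \<alpha> [b m, x])"
  unfolding br_b linear_sum[OF form_2_linear_left] by (simp add: form_2_simps sum_negf)

lemma ce_diff_form_2:
  assumes "\<alpha> \<in> forms 2"
  shows "ce_diff br \<alpha> [b i, b j, b l] = d2_coeff a (\<lambda>i j. \<alpha> [b i, b j]) i j l"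
  unfolding ce_diff_3 form_2_br[OF assms] d2_coeff_def by (simp add: sum.distrib sum_subtractf)

lemma form_3_br: "\<alpha> \<in> forms 3 \<Longrightarrow> \<alpha> [br (b i) (b j), x, y] = - (\<Sum>m = 1..5. a m i j * \<alpha> [b m, x, y])"
proof -
  assume "\<alpha> \<in> forms 3"
  then have lin: "linear (\<lambda>z. \<alpha> [z, x, y])" using forms_linear[of \<alpha> 3 "[undefined, x, y]" 0] by simp
  show ?thesis unfolding br_b linear_sum[OF lin] by (simp add: linear_scale[OF lin] linear_neg[OF lin] sum_negf)
qed

lemma ce_diff_form_3:
  assumes "\<alpha> \<in> forms 3"
  shows "ce_diff br \<alpha> [b i, b j, b l, b n] = d3_coeff a (\<lambda>i j l. \<alpha> [b i, b j, b l]) i j l n"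
  unfolding ce_diff_4 form_3_br[OF assms] d3_coeff_def by (simp add: sum.distrib sum_subtractf)

lemma ce_diff_forms_1:
  assumes "\<phi> \<in> forms 1"
  shows "ce_diff br \<phi> \<in> forms 2"
proof -
  note lin = form_1_linear[OF assms]
  have len: "ce_diff br \<phi> xs = 0" if "length xs \<noteq> 2" for xs
    unfolding ce_diff_def
  proof (intro sum.neutral ballI, clarify)
    fix i j assume ij: "i < j" "j < length xs"
    have "{k. k < length xs \<and> k \<in> - {i, j}} = {..<length xs} - {i, j}" by auto
    then have "length (nths xs (- {i, j})) = length xs - 2"
      using ij by (simp add: length_nths card_Diff_subset)
    then have "length (br (xs ! i) (xs ! j) # nths xs (- {i, j})) \<noteq> 1" using ij that by simp
    then show "(- 1) ^ (i + j) * \<phi> (br (xs ! i) (xs ! j) # nths xs (- {i, j})) = 0"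
      using forms_length[OF assms] by simp
  qed
  have two: "\<exists>x y. xs = [x, y]" if "length xs = 2" for xs :: "'a list"
    using that by (auto simp: length_Suc_conv numeral_2_eq_2)
  have "linear (\<lambda>z. - \<phi> [br x z])" "linear (\<lambda>z. - \<phi> [br z x])" for x
    by (rule linearI; simp add: bilinear_ladd[OF bilinear_br] bilinear_radd[OF bilinear_br] bilinear_lmul[OF bilinear_br]
        bilinear_rmul[OF bilinear_br] linear_add[OF lin] linear_scale[OF lin])+
  then show ?thesis
    unfolding forms_def using len br_self linear_0[OF lin]
    by (auto dest!: two simp: less_2_cases_iff ce_diff_2)
qed

lemma e_br_br: "e k [br (br (b i) (b j)) (b l)] = (\<Sum>m = 1..5. a m i j * a k m l)"
proof -
  have lin: "linear (\<lambda>x. e k [br x (b l)])"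
    by (rule linearI) (simp_all add: bilinear_ladd[OF bilinear_br] bilinear_lmul[OF bilinear_br]
        linear_add[OF e_linear] linear_scale[OF e_linear])
  show ?thesis
    unfolding br_b[of i j] linear_sum[OF lin] linear_scale[OF lin] by (simp add: a_def ce_diff_2)
qed

lemma br_jacobi': "br (br x y) z = br x (br y z) - br y (br x z)"
  using br_jacobi[of x y z] br_antisym[of z "br x y"] br_antisym[of z x] bilinear_rneg[OF bilinear_br, of y "br x z"]
  by (simp add: algebra_simps) 

sublocale double_hypo_coefficients a
proof
  fix k i j l n :: nat
  show "a k j i = - a k i j"
    by (simp add: a_def ce_diff_2 br_antisym[of "b j" "b i"] linear_neg[OF e_linear])
  have "br (br (b i) (b j)) (b l) - br (br (b i) (b l)) (b j) + br (br (b j) (b l)) (b i) = 0"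
    using br_jacobi'[of "b i" "b j" "b l"] br_antisym[of "b i" "br (b j) (b l)"] br_antisym[of "b j" "br (b i) (b l)"]
    by simp
  then have "e k [br (br (b i) (b j)) (b l) - br (br (b i) (b l)) (b j) + br (br (b j) (b l)) (b i)] = 0"
    by (simp only: linear_0[OF e_linear])
  then show "(\<Sum>m = 1..5. a m i j * a k m l - a m i l * a k m j + a m j l * a k m i) = 0"
    unfolding linear_add[OF e_linear] linear_diff[OF e_linear] e_br_br by (simp only: sum.distrib sum_subtractf)
  have eta_omega: "(\<eta> \<^bold>\<and> \<omega> k) [b i, b j, b l] = eta_omega k i j l"
    if "k \<in> {1..3}" "i \<in> {1..5}" "j \<in> {1..5}" "l \<in> {1..5}" for k i j l
    using that by (simp add: wedge_1_2 \<eta>_form \<omega>_form \<eta>_b \<omega>_b eta_omega_def)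
  have eta_omega_form: "\<eta> \<^bold>\<and> \<omega> k \<in> forms 3" if "k \<in> {1..3}" for k
    using wedge_forms[OF \<eta>_form \<omega>_form[OF that]] by simp
  assume i: "i \<in> {1..5}" and j: "j \<in> {1..5}" and l: "l \<in> {1..5}"
  have d2: "d2_coeff a (std_omega k) i j l = ce_diff br (\<omega> k) [b i, b j, b l]" if "k \<in> {1..3}" for k
    unfolding ce_diff_form_2[OF \<omega>_form[OF that]] d2_coeff_def
    by (rule sum.cong) (use that i j l in \<open>simp_all add: \<omega>_b\<close>)
  show "d2_coeff a (std_omega 1) i j l = 3 * eta_omega 2 i j l"
    using hypo i j l by (simp add: d2 double_hypo_def nearly_hypo_def eta_omega)
  show "d2_coeff a (std_omega 3) i j l = 0"
    using hypo by (simp add: d2 double_hypo_def hypo_def)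
  assume n: "n \<in> {1..5}"
  have d3: "d3_coeff a (eta_omega k) i j l n = ce_diff br (\<eta> \<^bold>\<and> \<omega> k) [b i, b j, b l, b n]" if "k \<in> {1..3}" for k
    unfolding ce_diff_form_3[OF eta_omega_form[OF that]] d3_coeff_def
    by (rule sum.cong) (use that i j l n in \<open>simp_all add: eta_omega\<close>)
  show "d3_coeff a (eta_omega 1) i j l n = 0" "d3_coeff a (eta_omega 2) i j l n = 0"
    using hypo by (simp_all add: d3 double_hypo_def hypo_def)
  show "d3_coeff a (eta_omega 3) i j l n
      = - 4 * (std_omega 1 i j * std_omega 1 l n - std_omega 1 i l * std_omega 1 j n + std_omega 1 i n * std_omega 1 j l)"
    using hypo i j l n by (simp add: d3 double_hypo_def nearly_hypo_def wedge_2_2 \<omega>_form \<omega>_b)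
qed

definition trace_ad :: "'a \<Rightarrow> real" where
  "trace_ad x = (\<Sum>k = 1..5. e k [br x (b k)])"

lemma linear_trace_ad: "linear trace_ad"
  unfolding trace_ad_def
  by (rule linearI) (simp_all add: bilinear_ladd[OF bilinear_br] bilinear_lmul[OF bilinear_br]
      linear_add[OF e_linear] linear_scale[OF e_linear] sum.distrib sum_distrib_left)

text \<open>
  The trace of a commutator vanishes: \<open>T x y\<close> is the trace of \<open>ad x \<circ> ad y\<close>, a double sum symmetric in \<open>x\<close> and \<open>y\<close>.
\<close>

lemma trace_ad_br: "trace_ad (br x y) = 0"
proof -
  define T where "T x y = (\<Sum>k = 1..5. e k [br x (br y (b k))])" for x y
  have expand: "e k [br x z] = (\<Sum>m = 1..5. e m [z] * e k [br x (b m)])" for k x z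
  proof -
    have lin: "linear (\<lambda>z. e k [br x z])"
      by (rule linearI) (simp_all add: bilinear_radd[OF bilinear_br] bilinear_rmul[OF bilinear_br]
          linear_add[OF e_linear] linear_scale[OF e_linear])
    have "e k [br x z] = e k [br x (\<Sum>m = 1..5. e m [z] *\<^sub>R b m)]" using basis_expansion[of z] by simp
    then show ?thesis by (simp add: linear_sum[OF lin] linear_scale[OF lin])
  qed
  have T: "T x y = (\<Sum>k = 1..5. \<Sum>m = 1..5. e m [br y (b k)] * e k [br x (b m)])" for x y
    unfolding T_def by (subst expand) simp
  have "T x y = T y x"
    unfolding T[of x y] T[of y x] by (subst sum.swap) (simp add: mult.commute)
  moreover have "trace_ad (br x y) = T x y - T y x"
    unfolding trace_ad_def T_def br_jacobi' by (simp add: linear_diff[OF e_linear] sum_subtractf)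
  ultimately show ?thesis by simp
qed

lemma trace_ad_b: "trace_ad (b i) = - (\<Sum>k = 1..5. a k i k)"
  by (simp add: trace_ad_def a_def ce_diff_2 sum_negf)

text \<open>
  If \<open>\<alpha>\<close> has an \<open>\<eta>\<close>-component, the algebra is not unimodular, and the trace form serves instead.
\<close>

lemma ex_horizontal_closed_form:
  fixes \<alpha> :: "'a \<Rightarrow> real"
  assumes "linear \<alpha>" "\<alpha> x \<noteq> 0" "\<And>x y. \<alpha> (br x y) = 0"
  shows "\<exists>\<beta> :: 'a \<Rightarrow> real. linear \<beta> \<and> (\<exists>x. \<beta> x \<noteq> 0) \<and> (\<forall>x y. \<beta> (br x y) = 0) \<and> \<beta> (b 5) = 0"
proof (cases "\<alpha> (b 5) = 0")
  case True
  have "\<exists>x. \<alpha> x \<noteq> 0" "\<forall>x y. \<alpha> (br x y) = 0" using assms(2,3) by blast+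
  then show ?thesis using assms(1) True by blast
next
  case False
  have closed: "(\<Sum>k = 1..5. \<alpha> (b k) * a k i j) = 0" for i j
    using assms(3)[of "b i" "b j"]
    by (simp add: br_b linear_sum[OF assms(1)] linear_scale[OF assms(1)] linear_neg[OF assms(1)] sum_negf mult.commute)
  have "\<not> (\<forall>i\<in>{1..5}. (\<Sum>k = 1..5. a k i k) = 0)"
    using closed_form_horizontal_if_unimodular[of "\<lambda>k. \<alpha> (b k)"] closed False by blast
  then have "\<exists>x. trace_ad x \<noteq> 0" using trace_ad_b by (metis neg_equal_0_iff_equal)
  then show ?thesis
    using linear_trace_ad trace_ad_br trace_ad_b[of 5] trace_5 by (intro exI[of _ trace_ad]) simp
qed

lemma omega_eq_e:
  "\<omega> 1 = e 1 \<^bold>\<and> e 2 + e 3 \<^bold>\<and> e 4" "\<omega> 2 = e 1 \<^bold>\<and> e 3 + e 4 \<^bold>\<and> e 2" "\<omega> 3 = e 1 \<^bold>\<and> e 4 + e 2 \<^bold>\<and> e 3"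
proof -
  have wedge_e: "e i \<^bold>\<and> e j \<in> forms 2" for i j
    using wedge_forms[OF e_form e_form] by simp
  have eq: "\<alpha> = \<beta>" if "\<alpha> \<in> forms 2" "\<beta> \<in> forms 2"
    "\<And>i j. i \<in> {1..5} \<Longrightarrow> j \<in> {1..5} \<Longrightarrow> \<alpha> [b i, b j] = \<beta> [b i, b j]" for \<alpha> \<beta>
    by (rule forms_2_eqI[OF that(1,2) span_b]) (use that(3) in blast)
  show "\<omega> 1 = e 1 \<^bold>\<and> e 2 + e 3 \<^bold>\<and> e 4"
    by (rule eq; (intro \<omega>_form subspace_add[OF subspace_forms] wedge_e)?)
      (simp_all add: \<omega>_b wedge_1_1[OF e_form e_form] e_b std_omega_eval)
  show "\<omega> 2 = e 1 \<^bold>\<and> e 3 + e 4 \<^bold>\<and> e 2"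
    by (rule eq; (intro \<omega>_form subspace_add[OF subspace_forms] wedge_e)?)
      (simp_all add: \<omega>_b wedge_1_1[OF e_form e_form] e_b std_omega_eval)
  show "\<omega> 3 = e 1 \<^bold>\<and> e 4 + e 2 \<^bold>\<and> e 3"
    by (rule eq; (intro \<omega>_form subspace_add[OF subspace_forms] wedge_e)?)
      (simp_all add: \<omega>_b wedge_1_1[OF e_form e_form] e_b std_omega_eval)
qed

lemma ce_diff_e_if_closed:
  assumes closed: "\<And>x y. e 1 [br x y] = 0"
  defines "\<mu> \<equiv> a 4 1 4"
  shows "ce_diff br (e 1) = 0"
    "ce_diff br (e 2) = \<mu> *\<^sub>R (e 3 \<^bold>\<and> e 4) - 3 *\<^sub>R (e 3 \<^bold>\<and> e 5)"
    "ce_diff br (e 3) = - (\<mu> *\<^sub>R (e 2 \<^bold>\<and> e 4)) + 3 *\<^sub>R (e 2 \<^bold>\<and> e 5)"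
    "ce_diff br (e 4) = \<mu> *\<^sub>R (e 1 \<^bold>\<and> e 4)"
    "ce_diff br (e 5) = - (4 *\<^sub>R (e 2 \<^bold>\<and> e 3)) + (\<mu>\<^sup>2 / 3) *\<^sub>R (e 1 \<^bold>\<and> e 4 - e 2 \<^bold>\<and> e 3)"
proof -
  have "a 1 i j = 0" for i j by (simp add: a_def ce_diff_2 closed)
  note coeffs = this coefficients_if_closed[OF this, folded \<mu>_def] \<mu>_def[symmetric] diag antisym_numerals
  have wedge_e: "e i \<^bold>\<and> e j \<in> forms 2" for i j
    using wedge_forms[OF e_form e_form] by simp
  note in_forms = subspace_add[OF subspace_forms] subspace_diff[OF subspace_forms] subspace_neg[OF subspace_forms]
    subspace_scale[OF subspace_forms] subspace_0[OF subspace_forms] wedge_e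
  have eq: "ce_diff br (e k) = \<beta>" if "\<beta> \<in> forms 2" "\<forall>i\<in>{1..5}. \<forall>j\<in>{1..5}. a k i j = \<beta> [b i, b j]" for \<beta> k
    by (rule forms_2_eqI[OF ce_diff_forms_1[OF e_form] that(1) span_b]) (use that(2) in \<open>auto simp: a_def\<close>)
  note eval = atLeastAtMost_1_5 wedge_1_1[OF e_form e_form] e_b coeffs
  show "ce_diff br (e 1) = 0"
    by (rule eq) (intro in_forms, simp add: eval)
  show "ce_diff br (e 2) = \<mu> *\<^sub>R (e 3 \<^bold>\<and> e 4) - 3 *\<^sub>R (e 3 \<^bold>\<and> e 5)"
    by (rule eq) (intro in_forms, simp add: eval)
  show "ce_diff br (e 3) = - (\<mu> *\<^sub>R (e 2 \<^bold>\<and> e 4)) + 3 *\<^sub>R (e 2 \<^bold>\<and> e 5)"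
    by (rule eq) (intro in_forms, simp add: eval)
  show "ce_diff br (e 4) = \<mu> *\<^sub>R (e 1 \<^bold>\<and> e 4)"
    by (rule eq) (intro in_forms, simp add: eval)
  show "ce_diff br (e 5) = - (4 *\<^sub>R (e 2 \<^bold>\<and> e 3)) + (\<mu>\<^sup>2 / 3) *\<^sub>R (e 1 \<^bold>\<and> e 4 - e 2 \<^bold>\<and> e 3)"
    by (rule eq) (intro in_forms, simp add: eval)
qed

end

lemma ex_functional_vanishing_on_span:
  fixes S :: "'a::real_vector set"
  assumes "span S \<noteq> UNIV"
  shows "\<exists>(\<alpha> :: 'a \<Rightarrow> real) x. linear \<alpha> \<and> \<alpha> x \<noteq> 0 \<and> (\<forall>y\<in>S. \<alpha> y = 0)"
proof -
  obtain x where x: "x \<notin> span S" using assms by blast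
  obtain B where B: "B \<subseteq> S" "independent B" "S \<subseteq> span B"
    using maximal_independent_subset[of S] by auto
  have "x \<notin> span B" using x span_mono[OF B(1)] by blast
  then have indep: "independent (insert x B)" using B(2) by (simp add: independent_insertI)
  obtain \<alpha> :: "'a \<Rightarrow> real" where \<alpha>: "linear \<alpha>" "\<forall>y\<in>insert x B. \<alpha> y = of_bool (y = x)"
    using linear_independent_extend[OF indep, of "\<lambda>y. of_bool (y = x)"] by blast
  have "x \<notin> B" using \<open>x \<notin> span B\<close> span_base by blast
  then have "\<alpha> y = 0" if "y \<in> S" for y
    using linear_eq_0_on_span[OF \<alpha>(1), of B y] \<alpha>(2) B(3) that by auto
  then show ?thesis using \<alpha> by (intro exI[of _ \<alpha>] exI[of _ x]) simp
qed

theorem proposition4p3: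
  fixes br :: "'a::real_vector \<Rightarrow> 'a \<Rightarrow> 'a"
    and \<eta> :: "'a form"
    and \<omega> :: "nat \<Rightarrow> 'a form"
  assumes "lie_algebra br"
    and "dim (UNIV :: 'a set) = 5"
    and "double_hypo br \<eta> \<omega>"
    and "derived_algebra br \<noteq> UNIV"
  shows "\<exists>(e :: nat \<Rightarrow> 'a form) (\<mu> :: real).
    coframe e 5 \<and>
    \<eta> = e 5 \<and>
    \<omega> 1 = e 1 \<^bold>\<and> e 2 + e 3 \<^bold>\<and> e 4 \<and>
    \<omega> 2 = e 1 \<^bold>\<and> e 3 + e 4 \<^bold>\<and> e 2 \<and>
    \<omega> 3 = e 1 \<^bold>\<and> e 4 + e 2 \<^bold>\<and> e 3 \<and>
    ce_diff br (e 1) = 0 \<and>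
    ce_diff br (e 2) = \<mu> *\<^sub>R (e 3 \<^bold>\<and> e 4) - 3 *\<^sub>R (e 3 \<^bold>\<and> e 5) \<and>
    ce_diff br (e 3) = - (\<mu> *\<^sub>R (e 2 \<^bold>\<and> e 4)) + 3 *\<^sub>R (e 2 \<^bold>\<and> e 5) \<and>
    ce_diff br (e 4) = \<mu> *\<^sub>R (e 1 \<^bold>\<and> e 4) \<and>
    ce_diff br (e 5) = - (4 *\<^sub>R (e 2 \<^bold>\<and> e 3))
      + (\<mu>\<^sup>2 / 3) *\<^sub>R (e 1 \<^bold>\<and> e 4 - e 2 \<^bold>\<and> e 3)"
proof -
  have su2: "su2_structure \<eta> \<omega>"
    using assms(3) by (simp add: double_hypo_def hypo_def)
  then have \<eta>: "\<eta> \<in> forms 1" and \<omega>: "\<And>k. k \<in> {1..3} \<Longrightarrow> \<omega> k \<in> forms 2"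
    by (auto simp: su2_structure_def)
  obtain b where b: "adapted_basis \<eta> \<omega> b"
    using ex_adapted_basis[OF assms(2) su2] by blast
  interpret B: adapted_lie_algebra br \<eta> \<omega> b
    by standard (fact assms(1) assms(3) b)+
  obtain \<alpha> :: "'a \<Rightarrow> real" and x where \<alpha>: "linear \<alpha>" "\<alpha> x \<noteq> 0" "\<And>x y. \<alpha> (br x y) = 0"
    using ex_functional_vanishing_on_span[OF assms(4)[unfolded derived_algebra_def]] by blast
  obtain \<beta> :: "'a \<Rightarrow> real" and x where \<beta>: "linear \<beta>" "\<beta> x \<noteq> 0" "\<And>x y. \<beta> (br x y) = 0" "\<beta> (b 5) = 0"
    using B.ex_horizontal_closed_form[OF \<alpha>] by blast
  obtain c where c: "adapted_basis \<eta> \<omega> c" "\<beta> (c 1) \<noteq> 0" "\<And>i. i \<in> {2..5} \<Longrightarrow> \<beta> (c i) = 0"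
    using adapted_basis_rotate[OF assms(2) \<eta> \<omega> b \<beta>(1,4,2)] by blast
  interpret C: adapted_lie_algebra br \<eta> \<omega> c
    by standard (fact assms(1) assms(3) c(1))+
  have \<beta>_e: "\<beta> x = \<beta> (c 1) * C.e 1 [x]" for x
  proof -
    have "\<beta> x = (\<Sum>k = 1..5. C.e k [x] * \<beta> (c k))"
      using arg_cong[OF C.basis_expansion[of x], of \<beta>] by (simp add: linear_sum[OF \<beta>(1)] linear_scale[OF \<beta>(1)])
    then show ?thesis by (simp add: atLeastAtMost_1_5 c(3))
  qed
  have closed: "C.e 1 [br x y] = 0" for x y
    using \<beta>_e[of "br x y"] \<beta>(3)[of x y] c(2) by simp
  have \<eta>_e: "\<eta> = C.e 5" by (simp add: dual_coframe_def)
  show ?thesis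
    by (intro exI[of _ C.e] exI[of _ "C.a 4 1 4"] conjI)
      (fact C.coframe_e \<eta>_e C.omega_eq_e C.ce_diff_e_if_closed[OF closed])+
qed

end
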